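(* Let $n\ge 2$ and let $\rho_{\mathrm{Aff}}:\tilde{A}_{n-1}\to\operatorname{Aut}F_n$ be the homomorphism defined in the context. (i) $\rho_{\mathrm{Aff}}$ is injective. (ii) An automorphism $\phi\in\operatorname{Aut}F_n$ lies in $\rho_{\mathrm{Aff}}(\tilde{A}_{n-1})$ if and only if there exist $w_1,\dots,w_n\in F_n$ and a permutation $\pi\in\mathcal{S}_n$ with $\phi(x_i)=w_i\,x_{\pi(i)}\,w_i^{-1}$ for all $i$, and there exists $w\in F_n$ of algebraic length $\ell(w)=0$ (sum of the exponents of all letters) with $\phi(x_1x_2\cdots x_n)=w\,x_1x_2\cdots x_n\,w^{-1}$.
   Context: $F_n$ is the free group on $x_1,\dots,x_n$. The affine braid group $\tilde{A}_{n-1}$ is the group with generators $\sigma_1,\dots,\sigma_n$ and relations (indices mod $n$) $\sigma_i\sigma_{i+1}\sigma_i=\sigma_{i+1}\sigma_i\sigma_{i+1}$ for all $i$, and $\sigma_i\sigma_j=\sigma_j\sigma_i$ for $|i-j|\ne 1\bmod n$. The homomorphism $\rho_{\mathrm{Aff}}$ is defined by: for $i\ne n$, $\rho_{\mathrm{Aff}}(\sigma_i)$: $x_i\mapsto x_ix_{i+1}x_i^{-1}$, $x_{i+1}\mapsto x_i$, $x_j\mapsto x_j$ ($j\ne i,i+1$); and $\rho_{\mathrm{Aff}}(\sigma_n)$: $x_1\mapsto x_n$, $x_n\mapsto x_nx_1x_n^{-1}$, $x_j\mapsto x_j$ ($j\ne 1,n$).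
   Formalization: For n = 2 the braid relation σ1σ2σ1 = σ2σ1σ2 is not imposed, so Ã_1 is the free group on σ1, σ2; with that relation ρ_Aff would not be well defined, since the two sides send x_2 to different elements. *)

theory Defs
  imports "HOL-Algebra.Group" "HOL-Combinatorics.Permutations"
begin

text \<open>Words in letters x_i^{+-1}: a letter (b,i) is x_i if b, and x_i inverse otherwise.
  Generators are indexed 1..n, as in the paper.\<close>

type_synonym letter = "bool \<times> nat"
type_synonym word = "letter list"

definition inv_letter :: "letter \<Rightarrow> letter" where
  "inv_letter = (\<lambda>(b, i). (\<not> b, i))"

definition inv_word :: "word \<Rightarrow> word" where
  "inv_word w = rev (map inv_letter w)"

fun red :: "word \<Rightarrow> word" where
  "red [] = []"
| "red (a # xs) = (case red xs of [] \<Rightarrow> [a]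
                    | b # ys \<Rightarrow> (if b = inv_letter a then ys else a # b # ys))"

definition reduced :: "word \<Rightarrow> bool" where
  "reduced w \<longleftrightarrow> (\<forall>i. Suc i < length w \<longrightarrow> w ! Suc i \<noteq> inv_letter (w ! i))"

definition free_group :: "nat \<Rightarrow> word monoid" where
  "free_group n = \<lparr> carrier = {w. reduced w \<and> (\<forall>(b, i) \<in> set w. i \<in> {1..n})},
                    monoid.mult = (\<lambda>x y. red (x @ y)),
                    monoid.one = [] \<rparr>"

definition gen :: "nat \<Rightarrow> word" where
  "gen i = [(True, i)]"

definition prod_gens :: "nat \<Rightarrow> word" where
  "prod_gens n = map (\<lambda>i. (True, i)) [1..<Suc n]"

definition alg_len :: "word \<Rightarrow> int" where
  "alg_len w = sum_list (map (\<lambda>(b, i). if b then 1 else -1) w)"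

definition subst :: "(nat \<Rightarrow> word) \<Rightarrow> word \<Rightarrow> word" where
  "subst f w = red (concat (map (\<lambda>(b, i). if b then f i else inv_word (f i)) w))"

definition compose :: "(nat \<Rightarrow> word) \<Rightarrow> (nat \<Rightarrow> word) \<Rightarrow> (nat \<Rightarrow> word)" where
  "compose f g = (\<lambda>k. subst f (g k))"

text \<open>Images of generators under rho_Aff(sigma_i) (letter (True,i)) and
  rho_Aff(sigma_i inverse) (letter (False,i)).\<close>
definition rho_gen :: "nat \<Rightarrow> letter \<Rightarrow> (nat \<Rightarrow> word)" where
  "rho_gen n a = (case a of
     (True, i) \<Rightarrow>
       (if i \<noteq> n then
          (\<lambda>k. if k = i then [(True, i), (True, i + 1), (False, i)]
               else if k = i + 1 then [(True, i)] else [(True, k)])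
        else
          (\<lambda>k. if k = 1 then [(True, n)]
               else if k = n then [(True, n), (True, 1), (False, n)] else [(True, k)]))
   | (False, i) \<Rightarrow>
       (if i \<noteq> n then
          (\<lambda>k. if k = i then [(True, i + 1)]
               else if k = i + 1 then [(False, i + 1), (True, i), (True, i + 1)] else [(True, k)])
        else
          (\<lambda>k. if k = n then [(True, 1)]
               else if k = 1 then [(False, 1), (True, n), (True, 1)] else [(True, k)])))"

fun rho_word :: "nat \<Rightarrow> word \<Rightarrow> (nat \<Rightarrow> word)" where
  "rho_word n [] = (\<lambda>k. [(True, k)])"
| "rho_word n (a # u) = compose (rho_gen n a) (rho_word n u)"

text \<open>Words in the generators sigma_1..sigma_n of the affine braid group
  (letter (b,i) stands for sigma_i^{+-1}).\<close>
definition sigma_words :: "nat \<Rightarrow> word set" where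
  "sigma_words n = {u. \<forall>(b, i) \<in> set u. i \<in> {1..n}}"

definition nxt :: "nat \<Rightarrow> nat \<Rightarrow> nat" where
  "nxt n i = (if i = n then 1 else i + 1)"

inductive braid_eq :: "nat \<Rightarrow> word \<Rightarrow> word \<Rightarrow> bool" for n where
  refl: "braid_eq n u u"
| sym: "braid_eq n u v \<Longrightarrow> braid_eq n v u"
| trans: "braid_eq n u v \<Longrightarrow> braid_eq n v w \<Longrightarrow> braid_eq n u w"
| cancel: "braid_eq n (u @ [a, inv_letter a] @ v) (u @ v)"
| braid: "3 \<le> n \<Longrightarrow> i \<in> {1..n} \<Longrightarrow>
    braid_eq n (u @ [(True, i), (True, nxt n i), (True, i)] @ v)
               (u @ [(True, nxt n i), (True, i), (True, nxt n i)] @ v)"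
| comm: "i \<in> {1..n} \<Longrightarrow> j \<in> {1..n} \<Longrightarrow> i \<noteq> j \<Longrightarrow> j \<noteq> nxt n i \<Longrightarrow> i \<noteq> nxt n j \<Longrightarrow>
    braid_eq n (u @ [(True, i), (True, j)] @ v) (u @ [(True, j), (True, i)] @ v)"

end

(* Appending sigma_i to a braid word acts on the tuple y of images of the generators by the Hurwitz
   move (y_i, y_{i+1}) -> (y_i y_{i+1} y_i^-1, y_i), indices taken cyclically. Each y_i is a reduced
   conjugate w_i x_{c(i)} w_i^-1; let the height be the sum of the lengths of the y_i. A move always
   changes the height, and sigma_i lowers it exactly when w_i x_{c(i)}^-1 is a prefix of w_{i+1}. If no
   move lowers it, then the cyclic word y_1 ... y_n reduces without losing any of the letters x_{c(i)};
   being conjugate to x_1 ... x_n it has length n, so all w_i coincide, hence are trivial, and the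
   condition of algebraic length 0 excludes a nontrivial rotation. This gives the description of
   the image.

   For faithfulness, descending paths from a tuple to (x_1, ..., x_n) are unique up to the braid
   relations by an argument in the style of Newman's lemma: two descents at the same tuple can be
   joined below it by a commutation or a braid relation, except when sigma_i^-1 and sigma_{i+1} both
   descend. That case never occurs on the orbit: let F_n act on the plane by transvections. For every
   tuple of the orbit, the y_i act as the parabolics attached to the sides of a centrally symmetric
   convex polygon (a Hurwitz move replaces one vertex by a point in the cone over a side), and by a
   ping-pong argument the cyclic order of the vertices rules out the two simultaneous descents. *)

theory Submission
  imports Complex_Main "HOL-Library.Sublist" Defs
begin

section \<open>Reduced words and the free group\<close>

text \<open>The hard peak is that of sigma_i^-1 and sigma_{i+1}: the words of both neighbours begin
  with the word of the middle entry, followed by its letter with opposite signs. Being a tuple of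
  conjugates does not exclude this, as (x_2 x_1 x_2^-1, x_2, x_2^-1 x_3 x_2) shows; the product of
  the entries has to come in, and it is not a local datum. The polygon makes it one. A nonzero
  vector up to sign is a point of the circle at infinity of the hyperbolic plane. There x_k is the
  parabolic that glues the two ideal edges joining its cusp to H_k and to H_{k+1}; gluing the ideal
  2n-gon with alternating vertices H_k and cusps identifies all H_k, and x_1 ... x_n fixes the line
  of H_1. A tuple of the orbit is another marking of the same picture, with its own H_k in the same
  cyclic order. Ping-pong translates between the position of a cusp on the circle and the first
  letters of a reduced word.\<close>

lemma inv_letter_invol [simp]: "inv_letter (inv_letter a) = a"
  by (cases a) (simp add: inv_letter_def)

lemma inv_letter_neq [simp]: "inv_letter a \<noteq> a" "a \<noteq> inv_letter a"
  by (cases a; simp add: inv_letter_def)+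

lemma inv_letter_pair [simp]: "inv_letter (b, i) = (\<not> b, i)"
  by (simp add: inv_letter_def)

lemma snd_inv_letter [simp]: "snd (inv_letter a) = snd a"
  by (cases a) simp

lemma inv_letter_eq_iff [simp]: "inv_letter a = inv_letter b \<longleftrightarrow> a = b"
  by (metis inv_letter_invol)

lemma inv_word_Nil [simp]: "inv_word [] = []"
  by (simp add: inv_word_def)

lemma inv_word_Cons [simp]: "inv_word (a # w) = inv_word w @ [inv_letter a]"
  by (simp add: inv_word_def)

lemma inv_word_append [simp]: "inv_word (u @ v) = inv_word v @ inv_word u"
  by (simp add: inv_word_def)

lemma inv_word_invol [simp]: "inv_word (inv_word w) = w"
  by (induction w) simp_all

lemma length_inv_word [simp]: "length (inv_word w) = length w"
  by (simp add: inv_word_def)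

lemma set_inv_word: "set (inv_word w) = inv_letter ` set w"
  by (simp add: inv_word_def)

lemma reduced_successively: "reduced w \<longleftrightarrow> successively (\<lambda>a b. b \<noteq> inv_letter a) w"
  by (simp add: reduced_def successively_conv_nth)

lemma reduced_Nil [simp]: "reduced []"
  by (simp add: reduced_def)

lemma reduced_single [simp]: "reduced [a]"
  by (simp add: reduced_def)

lemma reduced_append:
  "reduced (u @ v) \<longleftrightarrow>
     reduced u \<and> reduced v \<and> (u \<noteq> [] \<longrightarrow> v \<noteq> [] \<longrightarrow> hd v \<noteq> inv_letter (last u))"
  by (auto simp: reduced_successively successively_append_iff)

lemma reduced_Cons:
  "reduced (a # w) \<longleftrightarrow> reduced w \<and> (w \<noteq> [] \<longrightarrow> hd w \<noteq> inv_letter a)"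
  using reduced_append[of "[a]" w] by auto

lemma reduced_glue:
  assumes "reduced (u @ v)" "reduced (v @ w)" "v \<noteq> []"
  shows "reduced (u @ v @ w)"
  using assms by (auto simp: reduced_append)

lemma reduced_inv_word: "reduced w \<Longrightarrow> reduced (inv_word w)"
proof (induction w)
  case (Cons a w)
  then show ?case
    by (cases w) (auto simp: reduced_Cons reduced_append)
qed simp

text \<open>One step of \<open>red\<close>, isolated so that reduction becomes the action of a word,
  letter by letter, on the set of reduced words.\<close>

definition push :: "letter \<Rightarrow> word \<Rightarrow> word" where
  "push a ys = (case ys of [] \<Rightarrow> [a] | b # zs \<Rightarrow> (if b = inv_letter a then zs else a # ys))"

lemma red_Cons_push: "red (a # w) = push a (red w)"
  by (simp add: push_def split: list.split)

lemma red_eq_foldr: "red w = foldr push w []"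
  by (induction w) (auto simp: red_Cons_push simp del: red.simps(2))

lemma reduced_push: "reduced w \<Longrightarrow> reduced (push a w)"
  by (auto simp: push_def reduced_Cons split: list.split)

lemma push_push_inv: "reduced w \<Longrightarrow> push a (push (inv_letter a) w) = w"
  by (cases w; cases "tl w") (auto simp: push_def reduced_Cons)

lemma reduced_red: "reduced (red w)"
  by (induction w) (auto simp: red_Cons_push reduced_push simp del: red.simps(2))

lemma red_reduced: "reduced w \<Longrightarrow> red w = w"
  by (induction w) (auto simp: reduced_Cons split: list.split)

lemma red_red [simp]: "red (red w) = red w"
  by (simp add: red_reduced reduced_red)

lemma length_push: "length (push a w) \<le> Suc (length w)"
  by (auto simp: push_def split: list.split)

lemma length_red: "length (red w) \<le> length w"
proof (induction w)
  case (Cons a w)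
  then show ?case
    using length_push[of a "red w"] by (simp add: red_Cons_push del: red.simps(2))
qed simp

lemma set_push: "set (push a w) \<subseteq> insert a (set w)"
  by (auto simp: push_def split: list.split if_splits)

lemma set_red: "set (red w) \<subseteq> set w"
proof (induction w)
  case (Cons a w)
  then show ?case
    using set_push[of a "red w"] by (auto simp: red_Cons_push simp del: red.simps(2))
qed simp

text \<open>Reduction only deletes adjacent inverse letters, and these act trivially. The invariant
  \<open>P\<close> is present because \<open>push a\<close> and \<open>push (inv_letter a)\<close>
  are mutually inverse on reduced words only.\<close>

lemma foldr_red_on:
  assumes closed: "\<And>a x. P x \<Longrightarrow> P (F a x)"
    and inverse: "\<And>a x. P x \<Longrightarrow> F a (F (inv_letter a) x) = x"
    and x: "P x"
  shows "foldr F (red w) x = foldr F w x"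
proof (induction w)
  case (Cons a w)
  have P: "P (foldr F v x)" for v
    by (induction v) (auto simp: x closed)
  have "foldr F (push a ys) x = F a (foldr F ys x)" for ys
    using inverse[OF P] by (auto simp: push_def split: list.split)
  then show ?case
    using Cons by (simp add: red_Cons_push del: red.simps(2))
qed simp

lemma foldr_red:
  assumes "\<And>a x. F a (F (inv_letter a) x) = x"
  shows "foldr F (red w) x = foldr F w x"
  by (rule foldr_red_on[of "\<lambda>_. True"]) (simp_all add: assms)

lemma red_append_red1: "red (red u @ v) = red (u @ v)"
proof -
  have "foldr push (red u) (red v) = foldr push u (red v)"
    by (rule foldr_red_on[of reduced]) (auto simp: reduced_push push_push_inv reduced_red)
  then show ?thesis
    by (simp add: red_eq_foldr)
qed

lemma red_append_red2: "red (u @ red v) = red (u @ v)"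
  using red_red[of v] by (simp add: red_eq_foldr)

lemma red_cancel: "red (u @ inv_letter a # a # v) = red (u @ v)"
proof -
  have "red (inv_letter a # a # v) = red v"
    using push_push_inv[OF reduced_red, of "inv_letter a" v]
    by (simp add: red_Cons_push del: red.simps(2))
  then show ?thesis
    by (metis red_append_red2)
qed

lemma red_inv_left: "red (inv_word w @ w) = []"
  by (induction w) (use red_cancel in auto)

text \<open>The free group on all generators is written additively, because the type class of
  non-commutative groups is \<^class>\<open>group_add\<close>.\<close>

typedef freegrp = "{w. reduced w}" morphisms rep fg_abs
  by (rule exI[of _ "[]"]) simp

definition elt :: "word \<Rightarrow> freegrp" where
  "elt w = fg_abs (red w)"

lemma rep_elt: "rep (elt w) = red w"
  by (simp add: elt_def fg_abs_inverse reduced_red)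

lemma reduced_rep [simp]: "reduced (rep g)"
  using rep by simp

lemma elt_rep [simp]: "elt (rep g) = g"
  by (simp add: elt_def red_reduced rep_inverse)

lemma elt_eq_iff: "elt u = elt v \<longleftrightarrow> red u = red v"
  by (metis rep_elt elt_def)

lemma elt_red [simp]: "elt (red w) = elt w"
  by (simp add: elt_eq_iff)

lemma rep_elt_reduced: "reduced w \<Longrightarrow> rep (elt w) = w"
  by (simp add: rep_elt red_reduced)

instantiation freegrp :: group_add
begin

definition "0 = elt []"
definition "g + h = elt (rep g @ rep h)"
definition "- g = elt (inv_word (rep g))"
definition "g - h = g + - (h :: freegrp)"

instance
proof
  fix a b c :: freegrp
  show "a + b + c = a + (b + c)"
    by (simp add: plus_freegrp_def elt_eq_iff rep_elt red_append_red1 red_append_red2)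
  show "0 + a = a" "a + 0 = a"
    by (simp_all add: plus_freegrp_def zero_freegrp_def rep_elt)
  show "- a + a = 0"
    by (simp add: plus_freegrp_def uminus_freegrp_def zero_freegrp_def elt_eq_iff rep_elt
        red_append_red1 red_inv_left)
  show "a + - b = a - b"
    by (simp add: minus_freegrp_def)
qed

end

lemma elt_Nil [simp]: "elt [] = 0"
  by (simp add: zero_freegrp_def)

lemma elt_append: "elt (u @ v) = elt u + elt v"
  by (simp add: plus_freegrp_def elt_eq_iff rep_elt red_append_red1 red_append_red2)

lemma elt_Cons: "elt (a # v) = elt [a] + elt v"
  using elt_append[of "[a]" v] by simp

lemma elt_inv_word: "elt (inv_word w) = - elt w"
proof -
  have "elt (inv_word w @ w) = elt []"
    by (simp add: red_inv_left elt_eq_iff del: elt_Nil)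
  then have "elt (inv_word w) + elt w = 0"
    by (simp add: elt_append)
  then show ?thesis
    by (simp add: eq_neg_iff_add_eq_0)
qed

lemma elt_inv_letter: "elt [inv_letter a] = - elt [a]"
  using elt_inv_word[of "[a]"] by simp

lemma rep_0 [simp]: "rep 0 = []"
  using rep_elt[of "[]"] by simp

lemma rep_eq_Nil_iff [simp]: "rep g = [] \<longleftrightarrow> g = 0"
  by (metis elt_rep elt_Nil rep_0)

definition glen :: "freegrp \<Rightarrow> nat" where
  "glen g = length (rep g)"

lemma glen_elt_le: "glen (elt w) \<le> length w"
  by (simp add: glen_def rep_elt length_red)

lemma glen_elt_reduced: "reduced w \<Longrightarrow> glen (elt w) = length w"
  by (simp add: glen_def rep_elt_reduced)

lemma glen_add: "glen (g + h) \<le> glen g + glen h"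
  using glen_elt_le[of "rep g @ rep h"] by (simp add: elt_append glen_def)

lemma glen_uminus [simp]: "glen (- g) = glen g"
  by (simp add: uminus_freegrp_def glen_def rep_elt_reduced reduced_inv_word)

section \<open>Generators, homomorphisms and algebraic length\<close>

definition X :: "nat \<Rightarrow> freegrp" where
  "X i = elt [(True, i)]"

lemma elt_letter: "elt [(b, i)] = (if b then X i else - X i)"
  using elt_inv_letter[of "(True, i)"] by (simp add: X_def)

text \<open>The universal property of the free group. The target \<open>int\<close> yields the
  algebraic length, the target \<open>freegrp\<close> the endomorphisms.\<close>

definition ghom :: "(nat \<Rightarrow> 'g) \<Rightarrow> freegrp \<Rightarrow> ('g :: group_add)" where
  "ghom f g = foldr (\<lambda>(b, i) x. (if b then f i else - f i) + x) (rep g) 0"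

lemma ghom_elt: "ghom f (elt w) = foldr (\<lambda>(b, i) x. (if b then f i else - f i) + x) w 0"
  unfolding ghom_def rep_elt by (rule foldr_red) (auto simp: add.assoc[symmetric])

lemma ghom_0 [simp]: "ghom f 0 = 0"
  by (simp add: ghom_def)

lemma ghom_elt_Cons: "ghom f (elt ((b, i) # w)) = (if b then f i else - f i) + ghom f (elt w)"
  by (simp add: ghom_elt)

lemma ghom_X [simp]: "ghom f (X i) = f i"
  by (simp add: X_def ghom_elt)

lemma ghom_add: "ghom f (g + h) = ghom f g + ghom f h"
proof -
  have "ghom f (elt (u @ v)) = ghom f (elt u) + ghom f (elt v)" for u v
    by (induction u) (auto simp: ghom_elt_Cons add.assoc)
  from this[of "rep g" "rep h"] show ?thesis
    by (simp add: elt_append)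
qed

lemma ghom_uminus: "ghom f (- g) = - ghom f g"
proof -
  have "ghom f (- g) + ghom f g = 0"
    by (simp flip: ghom_add)
  then show ?thesis
    by (simp add: eq_neg_iff_add_eq_0)
qed

lemma elt_subst: "elt (subst f w) = ghom (\<lambda>i. elt (f i)) (elt w)"
  unfolding subst_def elt_red
  by (induction w) (auto simp: elt_append ghom_elt_Cons elt_inv_word)

definition glen0 :: "freegrp \<Rightarrow> int" where
  "glen0 g = ghom (\<lambda>_. 1) g"

lemma glen0_elt: "glen0 (elt w) = alg_len w"
  unfolding glen0_def alg_len_def
  by (induction w) (auto simp: ghom_elt_Cons)

lemma glen0_add [simp]: "glen0 (g + h) = glen0 g + glen0 h"
  by (simp add: glen0_def ghom_add)

lemma glen0_uminus [simp]: "glen0 (- g) = - glen0 g"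
  by (simp add: glen0_def ghom_uminus)

lemma glen0_diff [simp]: "glen0 (g - h) = glen0 g - glen0 h"
  using glen0_add[of g "- h"] by simp

lemma glen0_X [simp]: "glen0 (X i) = 1"
  by (simp add: glen0_def)

text \<open>The type has infinitely many free generators; this is the copy of F_n inside it.\<close>

definition Fsub :: "nat \<Rightarrow> freegrp set" where
  "Fsub n = {g. rep g \<in> carrier (free_group n)}"

lemma Fsub_iff: "g \<in> Fsub n \<longleftrightarrow> snd ` set (rep g) \<subseteq> {1..n}"
  by (auto simp: Fsub_def free_group_def)

lemma elt_in_Fsub: "snd ` set w \<subseteq> {1..n} \<Longrightarrow> elt w \<in> Fsub n"
  using set_red[of w] by (auto simp: Fsub_iff rep_elt)

lemma Fsub_0 [simp]: "0 \<in> Fsub n"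
  by (simp add: Fsub_iff)

lemma Fsub_add: "g \<in> Fsub n \<Longrightarrow> h \<in> Fsub n \<Longrightarrow> g + h \<in> Fsub n"
  unfolding plus_freegrp_def by (rule elt_in_Fsub) (auto simp: Fsub_iff)

lemma Fsub_uminus: "g \<in> Fsub n \<Longrightarrow> - g \<in> Fsub n"
  unfolding uminus_freegrp_def
  by (rule elt_in_Fsub) (auto simp: Fsub_iff set_inv_word image_image)

lemma Fsub_X: "i \<in> {1..n} \<Longrightarrow> X i \<in> Fsub n"
  unfolding X_def by (rule elt_in_Fsub) simp

section \<open>Conjugates of generators\<close>

text \<open>The Knuth-Bendix completion of the group axioms in additive notation: sums associate to
  the right and adjacent inverses cancel, which settles word identities in a non-commutative
  group.\<close>

lemmas group_simps = diff_conv_add_uminus minus_add add.assoc add_minus_cancel minus_add_cancel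
  minus_minus add_0_left add_0_right minus_zero right_minus left_minus

definition conj_gen :: "word \<Rightarrow> nat \<Rightarrow> freegrp" where
  "conj_gen w c = elt w + X c - elt w"

text \<open>Trailing letters x_c^{+-1} of w commute with x_c. Once they are stripped, w x_c w^-1 is
  reduced as written, so its length and its prefixes can be read off w.\<close>

definition good :: "nat \<Rightarrow> word \<Rightarrow> bool" where
  "good c w \<longleftrightarrow> reduced w \<and> (w = [] \<or> snd (last w) \<noteq> c)"

lemma good_snoc: "good c w \<Longrightarrow> reduced (w @ [(b, c)])"
  by (cases "last w") (auto simp: good_def reduced_append)

lemma reduced_conj_word:
  assumes "good c w"
  shows "reduced (w @ [(b, c)] @ inv_word w)"
proof (rule reduced_glue)
  show "reduced (w @ [(b, c)])"
    using good_snoc[OF assms] .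
  show "reduced ([(b, c)] @ inv_word w)"
    using reduced_inv_word[OF good_snoc[OF assms, of "\<not> b"]] by simp
qed simp

lemma conj_gen_elt: "conj_gen w c = elt (w @ [(True, c)] @ inv_word w)"
  unfolding conj_gen_def elt_append elt_inv_word X_def by (simp only: group_simps)

lemma rep_conj_gen: "good c w \<Longrightarrow> rep (conj_gen w c) = w @ [(True, c)] @ inv_word w"
  using reduced_conj_word[of c w True] by (simp only: conj_gen_elt rep_elt_reduced)

lemma glen_conj_gen: "good c w \<Longrightarrow> glen (conj_gen w c) = 2 * length w + 1"
  by (simp add: glen_def rep_conj_gen)

lemma glen_conj_gen_le: "glen (conj_gen w c) \<le> 2 * length w + 1"
  using glen_elt_le[of "w @ [(True, c)] @ inv_word w"] by (simp add: conj_gen_elt)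

text \<open>The stripped letters are kept in \<open>z\<close>, since \<open>good_strip_long\<close>
  has to know that nothing up to a letter of another index is lost.\<close>

lemma good_strip:
  "reduced u \<Longrightarrow> \<exists>w z. u = w @ z \<and> good c w \<and> (\<forall>a\<in>set z. snd a = c) \<and> conj_gen u c = conj_gen w c"
proof (induction u rule: rev_induct)
  case Nil
  then show ?case
    by (auto simp: good_def)
next
  case (snoc a u)
  show ?case
  proof (cases "snd a = c")
    case False
    then show ?thesis
      using snoc.prems by (intro exI[of _ "u @ [a]"] exI[of _ "[]"]) (auto simp: good_def)
  next
    case True
    then obtain b where a: "a = (b, c)"
      by (cases a) auto
    from snoc obtain w z where w: "u = w @ z" "good c w" "\<forall>a\<in>set z. snd a = c"
        "conj_gen u c = conj_gen w c"
      by (auto simp: reduced_append)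
    have "conj_gen (u @ [a]) c = conj_gen u c"
      unfolding conj_gen_def elt_append a elt_letter by (simp only: group_simps split: if_splits) simp
    then show ?thesis
      using w a by (intro exI[of _ w] exI[of _ "z @ [a]"]) auto
  qed
qed

lemma good_strip_long:
  assumes "reduced (p @ (b, d) # q)" "d \<noteq> c"
  obtains w where "good c w" "conj_gen (p @ (b, d) # q) c = conj_gen w c" "length p < length w"
proof -
  obtain w z where w: "p @ (b, d) # q = w @ z" "good c w" "\<forall>a\<in>set z. snd a = c"
      "conj_gen (p @ (b, d) # q) c = conj_gen w c"
    using good_strip[OF assms(1)] by blast
  have "length p < length w"
  proof (rule ccontr)
    assume *: "\<not> length p < length w"
    have "length (p @ (b, d) # q) = length (w @ z)"
      by (simp only: w(1))
    moreover have "(w @ z) ! length p = (b, d)"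
      by (simp flip: w(1))
    ultimately have "(b, d) \<in> set z"
      using * by (auto simp: nth_append in_set_conv_nth intro!: exI[of _ "length p - length w"])
    then show False
      using w(3) assms(2) by auto
  qed
  with w show ?thesis
    using that by blast
qed

section \<open>Conjugating one conjugate of a generator by another\<close>

definition conj_by :: "bool \<Rightarrow> freegrp \<Rightarrow> freegrp \<Rightarrow> freegrp" where
  "conj_by b g h = (if b then g + h - g else - g + h + g)"

lemma conj_by_conj_gen:
  "conj_by b (conj_gen w1 c1) (conj_gen w2 c2) = conj_gen (w1 @ [(b, c1)] @ inv_word w1 @ w2) c2"
  unfolding conj_by_def conj_gen_def elt_append elt_inv_word elt_letter
  by (cases b) (simp_all only: group_simps if_True if_False)

lemma conj_by_conj_gen_prefix:
  "conj_by b (conj_gen w1 c1) (conj_gen (w1 @ [(\<not> b, c1)] @ s) c2) = conj_gen (w1 @ s) c2"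
  unfolding conj_by_def conj_gen_def elt_append elt_inv_word elt_letter
  by (cases b) (simp_all only: group_simps if_True if_False not_True_eq_False not_False_eq_True)

lemma conj_by_shorter:
  assumes "good c2 w2" "prefix (w1 @ [(\<not> b, c1)]) w2"
  shows "glen (conj_by b (conj_gen w1 c1) (conj_gen w2 c2)) < glen (conj_gen w2 c2)"
proof -
  from assms(2) obtain s where s: "w2 = w1 @ [(\<not> b, c1)] @ s"
    by (auto elim: prefixE)
  show ?thesis
    using glen_conj_gen_le[of "w1 @ s" c2] glen_conj_gen[OF assms(1)]
    unfolding s conj_by_conj_gen_prefix by simp
qed

lemma reduced_inv_append:
  assumes "reduced s" "reduced t" "s = [] \<or> t = [] \<or> hd s \<noteq> hd t"
  shows "reduced (inv_word s @ t)"
  using assms reduced_inv_word[OF assms(1)]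
  by (cases s; cases t) (auto simp: reduced_append reduced_Cons)

text \<open>With the longest common prefix p split off, the new conjugator is p s x s^-1 t, where x
  is the letter \<open>(b, c1)\<close>. The missing prefix is exactly what keeps x from cancelling,
  so this word is reduced and longer than p t. Together with \<open>conj_by_shorter\<close> it
  follows that a move never preserves the height.\<close>

lemma conj_by_longer:
  assumes w1: "good c1 w1" and w2: "good c2 w2" and "c1 \<noteq> c2"
    and no_prefix: "\<not> prefix (w1 @ [(\<not> b, c1)]) w2"
  shows "glen (conj_gen w2 c2) < glen (conj_by b (conj_gen w1 c1) (conj_gen w2 c2))"
proof -
  obtain p s t where st: "w1 = p @ s" "w2 = p @ t" "s = [] \<or> t = [] \<or> hd s \<noteq> hd t"
    using longest_common_prefix[of w1 w2] by blast
  define u where "u = p @ s @ [(b, c1)] @ inv_word s @ t"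
  have "conj_gen (w1 @ [(b, c1)] @ inv_word w1 @ w2) c2 = conj_gen u c2"
    unfolding conj_gen_def st u_def elt_append elt_inv_word inv_word_append
    by (simp only: group_simps)
  then have eq: "conj_by b (conj_gen w1 c1) (conj_gen w2 c2) = conj_gen u c2"
    by (simp add: conj_by_conj_gen)
  have red_s: "reduced s" and red_t: "reduced t"
    using w1 w2 st by (auto simp: good_def reduced_append)
  have r1: "reduced ((p @ s) @ [(b, c1)])"
    using good_snoc[OF w1] st by simp
  have r2: "reduced ([(b, c1)] @ inv_word s @ t)"
  proof (cases "s = []")
    case True
    then show ?thesis
      using no_prefix red_t st by (cases t) (auto simp: reduced_Cons)
  next
    case False
    have "reduced ([(b, c1)] @ inv_word s)"
      using good_snoc[OF w1, of "\<not> b"] st reduced_inv_word[of "s @ [(\<not> b, c1)]"]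
      by (auto simp: reduced_append)
    moreover have "reduced (inv_word s @ t)"
      using st(3) red_s red_t by (rule reduced_inv_append[rotated 2])
    moreover have "inv_word s \<noteq> []"
      using False by (cases s) auto
    ultimately show ?thesis
      using reduced_glue[of "[(b, c1)]" "inv_word s" t] by simp
  qed
  have red_u: "reduced u"
    using reduced_glue[OF r1 r2] by (simp add: u_def)
  show ?thesis
  proof (cases "t = []")
    \<comment> \<open>Here the new conjugator may end in letters of index \<open>c2\<close>, which
      get stripped; the stripping stops at \<open>(b, c1)\<close> at the latest because the indices
      differ.\<close>
    case True
    have "reduced ((p @ s) @ (b, c1) # (inv_word s @ t))"
      using red_u by (simp add: u_def)
    from good_strip_long[OF this \<open>c1 \<noteq> c2\<close>] obtain w where
      "good c2 w" "conj_gen u c2 = conj_gen w c2" "length (p @ s) < length w"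
      by (auto simp: u_def)
    then show ?thesis
      using eq glen_conj_gen[OF w2] True st by (simp add: glen_conj_gen)
  next
    case False
    then have "good c2 u"
      using w2 red_u st by (simp add: good_def u_def)
    then show ?thesis
      using eq glen_conj_gen[OF w2] st by (simp add: glen_conj_gen u_def)
  qed
qed

text \<open>Two neighbouring entries contribute x_c w^-1 w' x_c' to the product. The two excluded
  prefixes are the only ways in which one of the marked letters could cancel into the gap w^-1 w';
  they are the two descents at this pair.\<close>

lemma reduced_gap:
  assumes w: "good c w" and w': "good c' w'"
    and "\<not> prefix (w @ [(False, c)]) w'" and "\<not> prefix (w' @ [(True, c')]) w"
  shows "reduced ((True, c) # rep (- elt w + elt w') @ [(True, c')])"
proof -
  obtain p s t where st: "w = p @ s" "w' = p @ t" "s = [] \<or> t = [] \<or> hd s \<noteq> hd t"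
    using longest_common_prefix[of w w'] by blast
  have red_s: "reduced s" and red_t: "reduced t"
    using w w' st by (auto simp: good_def reduced_append)
  have "- elt w + elt w' = elt (inv_word s @ t)"
    unfolding st elt_append elt_inv_word by (simp only: group_simps)
  moreover have st_red: "reduced (inv_word s @ t)"
    using st(3) red_s red_t by (rule reduced_inv_append[rotated 2])
  ultimately have rep: "rep (- elt w + elt w') = inv_word s @ t"
    by (simp add: rep_elt_reduced)
  have 1: "reduced ((True, c) # inv_word s @ t)"
  proof (cases "s = []")
    case True
    then show ?thesis
      using assms(3) red_t st by (cases t) (auto simp: reduced_Cons)
  next
    case False
    have "reduced ([(True, c)] @ inv_word s)"
      using good_snoc[OF w, of False] st reduced_inv_word[of "s @ [(False, c)]"]
      by (auto simp: reduced_append)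
    moreover have "inv_word s \<noteq> []"
      using False by (cases s) auto
    ultimately show ?thesis
      using reduced_glue[of "[(True, c)]" "inv_word s" t] st_red by simp
  qed
  have 2: "reduced ((inv_word s @ t) @ [(True, c')])"
  proof (cases "t = []")
    case True
    then show ?thesis
      using assms(4) red_s st reduced_inv_append[of s "[(True, c')]"] by (cases s) auto
  next
    case False
    then show ?thesis
      using reduced_glue[of "inv_word s" t "[(True, c')]"] st_red good_snoc[OF w', of True] st
      by (auto simp: reduced_append)
  qed
  show ?thesis
  proof (cases "inv_word s @ t = []")
    case True
    then show ?thesis
      unfolding rep True by (simp add: reduced_Cons)
  next
    case False
    then show ?thesis
      using reduced_glue[of "[(True, c)]" "inv_word s @ t" "[(True, c')]"] 1 2 rep by simp
  qed
qed

section \<open>Conjugacy of cyclically reduced and of positive words\<close>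

lemma elt_concat_replicate: "elt (concat (replicate m C)) = sum_list (replicate m (elt C))"
  by (induction m) (simp_all add: elt_append)

lemma sum_list_replicate_conj:
  "sum_list (replicate m (g + h - g)) = g + sum_list (replicate m h) - (g :: 'a :: group_add)"
  by (induction m) (simp_all only: replicate.simps sum_list.Nil sum_list.Cons group_simps)

lemma glen_sum_list_replicate: "glen (sum_list (replicate m h)) \<le> m * glen h"
proof (induction m)
  case (Suc m)
  then show ?case
    using glen_add[of h "sum_list (replicate m h)"] by simp
qed (simp add: glen_def)

text \<open>Compare the growth of the lengths of the powers of both sides.\<close>

lemma cyclically_reduced_minimal:
  assumes reduced: "\<And>m. reduced (concat (replicate m C))"
    and conj: "elt C = g + h - g"
  shows "length C \<le> glen h"
proof (rule ccontr)
  assume less: "\<not> length C \<le> glen h"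
  \<comment> \<open>The conjugator costs at most 2 |g|, whatever the exponent; one more than that is
    an exponent at which linear growth wins.\<close>
  define m where "m = 2 * glen g + 1"
  have "m * length C = glen (elt (concat (replicate m C)))"
    by (simp add: glen_elt_reduced[OF reduced] length_concat sum_list_replicate)
  also have "\<dots> = glen (g + sum_list (replicate m h) + - g)"
    by (simp add: elt_concat_replicate conj sum_list_replicate_conj)
  also have "\<dots> \<le> 2 * glen g + m * glen h"
    using glen_add[of "g + sum_list (replicate m h)" "- g"] glen_add[of g "sum_list (replicate m h)"]
      glen_sum_list_replicate[of m h] by simp
  finally have "m * length C < m * (glen h + 1)"
    unfolding m_def by (simp add: algebra_simps)
  moreover have "m * (glen h + 1) \<le> m * length C"
    using less by (intro mult_le_mono2) simp
  ultimately show False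
    by simp
qed

definition pos :: "nat list \<Rightarrow> word" where
  "pos = map (Pair True)"

lemma pos_simps [simp]:
  "pos [] = []" "pos (i # is) = (True, i) # pos is" "pos (is @ js) = pos is @ pos js"
  "length (pos is) = length is" "pos is = [] \<longleftrightarrow> is = []" "pos is = pos js \<longleftrightarrow> is = js"
  by (auto simp: pos_def inj_on_def)

lemma reduced_pos: "reduced (pos is)"
  by (auto simp: reduced_def pos_def inv_letter_def)

text \<open>Each letter at the end of g cancels against one end of the positive word and rotates it
  by one place, so the rotation is counted by the algebraic length of g. It is counted only modulo
  the length of the word, since g may be multiplied by powers of the word itself.\<close>

lemma conjugate_positive_words:
  assumes "length is = length js" "is \<noteq> []" "elt (pos is) = g + elt (pos js) - g"
  shows "\<exists>k. is = rotate k js \<and> int (length js) dvd int k + glen0 g"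
  using assms
proof (induction "glen g" arbitrary: g js)
  case 0
  then have "g = 0"
    by (simp add: glen_def)
  with 0 show ?case
    by (intro exI[of _ 0]) (simp add: elt_eq_iff red_reduced reduced_pos glen0_def)
next
  case (Suc l)
  define w where "w = rep g"
  have "w \<noteq> []"
    using Suc.hyps(2) by (auto simp: glen_def w_def)
  then obtain w' a where w: "w = w' @ [a]"
    by (metis rev_exhaust)
  have "reduced w"
    by (simp add: w_def)
  then have "reduced w'"
    by (simp add: w reduced_append)
  obtain b d where a: "a = (b, d)"
    by (cases a)
  define g' where "g' = elt w'"
  have g: "g = g' + elt [a]"
    by (metis elt_append elt_rep g'_def w w_def)
  have l: "l = glen g'"
    using Suc.hyps(2) glen_elt_reduced[OF \<open>reduced w'\<close>] w
    by (simp add: g'_def glen_def flip: w_def)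
  have "js \<noteq> []"
    using Suc.prems by auto
  \<comment> \<open>If the last letter of g cancelled at neither end, the conjugate would be reduced
    as written and longer than \<open>pos is\<close>.\<close>
  consider js' where "js = d # js'" "\<not> b" | js' where "js = js' @ [d]" "b"
  proof -
    have "\<not> (a \<noteq> inv_letter (hd (pos js)) \<and> a \<noteq> last (pos js))"
    proof
      assume "a \<noteq> inv_letter (hd (pos js)) \<and> a \<noteq> last (pos js)"
      then have *: "hd (pos js) \<noteq> inv_letter a" "inv_letter a \<noteq> inv_letter (last (pos js))"
        by auto
      have last_w: "last w = a" and hd_w: "hd (inv_word w) = inv_letter a"
        by (simp_all add: w)
      have 1: "reduced (w @ pos js)"
        using *(1) \<open>reduced w\<close> reduced_pos[of js] \<open>w \<noteq> []\<close> by (auto simp: reduced_append last_w)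
      have 2: "reduced (pos js @ inv_word w)"
        using *(2) reduced_inv_word[OF \<open>reduced w\<close>] reduced_pos[of js] by (auto simp: reduced_append hd_w)
      have "reduced (w @ pos js @ inv_word w)"
        using reduced_glue[OF 1 2] \<open>js \<noteq> []\<close> by simp
      moreover have "elt (w @ pos js @ inv_word w) = elt (pos is)"
        unfolding Suc.prems elt_append elt_inv_word w_def elt_rep by (simp only: group_simps)
      ultimately have "w @ pos js @ inv_word w = pos is"
        by (metis rep_elt_reduced reduced_pos)
      then have "length (w @ pos js @ inv_word w) = length (pos is)"
        by simp
      then show False
        using Suc.prems \<open>w \<noteq> []\<close> by simp
    qed
    moreover have "hd (pos js) = (True, hd js)"
      using \<open>js \<noteq> []\<close> by (cases js) auto
    moreover have "last (pos js) = (True, last js)"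
      using \<open>js \<noteq> []\<close> by (cases js rule: rev_cases) auto
    ultimately have "(\<not> b \<and> d = hd js) \<or> (b \<and> d = last js)"
      by (auto simp: a)
    then show ?thesis
      using that \<open>js \<noteq> []\<close> by (metis append_butlast_last_id list.collapse)
  qed
  then show ?case
  proof cases
    case (1 js')
    have "elt (pos is) = g' + elt (pos (js' @ [d])) - g'"
      unfolding Suc.prems g a using 1 elt_Cons[of "(True, d)" "pos js'"]
      by (simp only: pos_simps elt_append elt_letter group_simps if_True if_False)
    from Suc.hyps(1)[OF l _ _ this] obtain k where
      k: "is = rotate k (js' @ [d])" "int (length (js' @ [d])) dvd int k + glen0 g'"
      using Suc.prems 1 by auto
    have "is = rotate (Suc k) js"
      using k(1) 1 by (simp add: rotate1_rotate_swap)
    moreover have "int (Suc k) + glen0 g = int k + glen0 g'"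
      using 1 by (simp add: g a elt_letter)
    ultimately show ?thesis
      using k(2) 1 by (intro exI[of _ "Suc k"]) (metis length_append_singleton length_Cons)
  next
    case (2 js')
    have "elt (pos is) = g' + elt (pos (d # js')) - g'"
      unfolding Suc.prems g a using 2 elt_Cons[of "(True, d)" "pos js'"]
      by (simp only: pos_simps elt_append elt_letter group_simps if_True if_False)
    from Suc.hyps(1)[OF l _ _ this] obtain k where
      k: "is = rotate k (d # js')" "int (length (d # js')) dvd int k + glen0 g'"
      using Suc.prems 2 by auto
    \<comment> \<open>One place backwards is \<open>length js'\<close> places forwards, which
      accounts for an extra multiple of the length below.\<close>
    have "d # js' = rotate (length js') js"
      unfolding 2 by (simp add: rotate_append)
    then have "is = rotate (k + length js') js"
      using k(1) by (simp add: rotate_rotate)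
    moreover have "int (k + length js') + glen0 g = int k + glen0 g' + int (length (d # js'))"
      using 2 by (simp add: g a elt_letter)
    ultimately show ?thesis
      using dvd_add[OF k(2) dvd_refl] 2
      by (intro exI[of _ "k + length js'"]) (metis length_append_singleton length_Cons)
  qed
qed

section \<open>Braid relations and Hurwitz moves\<close>

declare braid_eq.trans [trans]

lemma braid_eq_cong: "braid_eq n u v \<Longrightarrow> braid_eq n (p @ u @ q) (p @ v @ q)"
proof (induction rule: braid_eq.induct)
  case (cancel u a v)
  then show ?case
    using braid_eq.cancel[of n "p @ u" a "v @ q"] by simp
next
  case (braid i u v)
  then show ?case
    using braid_eq.braid[of n i "p @ u" "v @ q"] by simp
next
  case (comm i j u v)
  then show ?case
    using braid_eq.comm[of i n j "p @ u" "v @ q"] by simp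
qed (blast intro: braid_eq.intros)+

lemma braid_eq_append: "braid_eq n u u' \<Longrightarrow> braid_eq n v v' \<Longrightarrow> braid_eq n (u @ v) (u' @ v')"
  using braid_eq_cong[of n u u' "[]" v] braid_eq_cong[of n v v' u' "[]"]
  by (auto intro: braid_eq.trans)

lemma braid_eq_Cons: "braid_eq n u v \<Longrightarrow> braid_eq n (a # u) (a # v)"
  using braid_eq_cong[of n u v "[a]" "[]"] by simp

lemma braid_eq_inv_right: "braid_eq n (u @ inv_word u) []"
proof (induction u)
  case (Cons a u)
  then show ?case
    using braid_eq_cong[OF Cons.IH, of "[a]" "[inv_letter a]"] braid_eq.cancel[of n "[]" a "[]"]
    by (auto intro: braid_eq.trans)
qed (simp add: braid_eq.refl)

lemma braid_eq_inv_left: "braid_eq n (inv_word u @ u) []"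
  using braid_eq_inv_right[of n "inv_word u"] by simp

lemma braid_eq_iff_quotient: "braid_eq n u v \<longleftrightarrow> braid_eq n (u @ inv_word v) []"
proof
  assume "braid_eq n u v"
  then have "braid_eq n (u @ inv_word v) (v @ inv_word v)"
    by (intro braid_eq_append braid_eq.refl)
  then show "braid_eq n (u @ inv_word v) []"
    using braid_eq_inv_right braid_eq.trans by blast
next
  assume "braid_eq n (u @ inv_word v) []"
  then have "braid_eq n ((u @ inv_word v) @ v) ([] @ v)"
    by (intro braid_eq_append braid_eq.refl)
  moreover have "braid_eq n (u @ inv_word v @ v) (u @ [])"
    by (intro braid_eq_append braid_eq.refl braid_eq_inv_left)
  ultimately show "braid_eq n u v"
    by (auto intro: braid_eq.trans braid_eq.sym)
qed

lemma braid_eq_inv_word: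
  assumes "braid_eq n u v"
  shows "braid_eq n (inv_word u) (inv_word v)"
proof -
  have "braid_eq n (inv_word u @ u @ inv_word v) (inv_word u @ v @ inv_word v)"
    by (rule braid_eq_cong[OF assms])
  moreover have "braid_eq n ((inv_word u @ u) @ inv_word v) ([] @ inv_word v)"
    by (intro braid_eq_append braid_eq.refl braid_eq_inv_left)
  moreover have "braid_eq n (inv_word u @ v @ inv_word v) (inv_word u @ [])"
    by (intro braid_eq_append braid_eq.refl braid_eq_inv_right)
  ultimately show ?thesis
    by simp (meson braid_eq.sym braid_eq.trans)
qed

lemma braid_eq_commute_inv:
  assumes "braid_eq n [a, b] [b, a]"
  shows "braid_eq n [inv_letter a, b] [b, inv_letter a]"
proof -
  have "braid_eq n [inv_letter a, b] [inv_letter a, b, a, inv_letter a]"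
    using braid_eq.cancel[of n "[inv_letter a, b]" a "[]"] by (auto intro: braid_eq.sym)
  also have "braid_eq n \<dots> [inv_letter a, a, b, inv_letter a]"
    using braid_eq_cong[OF braid_eq.sym[OF assms], of "[inv_letter a]" "[inv_letter a]"] by simp
  also have "braid_eq n \<dots> [b, inv_letter a]"
    using braid_eq.cancel[of n "[]" "inv_letter a" "[b, inv_letter a]"] by simp
  finally show ?thesis .
qed

lemma braid_eq_far_commute:
  assumes "i \<in> {1..n}" "j \<in> {1..n}" "i \<noteq> j" "j \<noteq> nxt n i" "i \<noteq> nxt n j"
  shows "braid_eq n [(b, i), (d, j)] [(d, j), (b, i)]"
proof -
  have 1: "braid_eq n [(True, i), (True, j)] [(True, j), (True, i)]"
    using braid_eq.comm[OF assms, of "[]" "[]"] by simp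
  have 2: "braid_eq n [(b, i), (True, j)] [(True, j), (b, i)]"
    using 1 braid_eq_commute_inv[OF 1] by (cases b) auto
  show ?thesis
    using 2 braid_eq_commute_inv[OF braid_eq.sym[OF 2]] by (cases d) (auto intro: braid_eq.sym)
qed

context
  fixes n i j :: nat
  assumes n3: "3 \<le> n" and i: "i \<in> {1..n}" and j: "j = nxt n i"
begin

lemma braid_rel_pos: "braid_eq n [(True, i), (True, j), (True, i)] [(True, j), (True, i), (True, j)]"
  using braid_eq.braid[OF n3 i, of "[]" "[]"] j by simp

lemma braid_rel_neg:
  "braid_eq n [(False, i), (False, j), (False, i)] [(False, j), (False, i), (False, j)]"
  using braid_eq_inv_word[OF braid_rel_pos] by simp

text \<open>This relation and the next both start with sigma_i on one side and sigma_j^-1 on the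
  other. They are the two candidates for closing such a peak, and the nesting of the outer words
  decides between them.\<close>

lemma braid_rel_mixed1:
  "braid_eq n [(True, i), (True, j), (False, i)] [(False, j), (True, i), (True, j)]"
proof -
  have "braid_eq n [(True, i), (True, j), (False, i)]
      [(False, j), (True, j), (True, i), (True, j), (False, i)]"
    using braid_eq.cancel[of n "[]" "(False, j)"] by (auto intro: braid_eq.sym)
  also have "braid_eq n \<dots> [(False, j), (True, i), (True, j), (True, i), (False, i)]"
    using braid_eq_cong[OF braid_eq.sym[OF braid_rel_pos], of "[(False, j)]" "[(False, i)]"] by simp
  also have "braid_eq n \<dots> [(False, j), (True, i), (True, j)]"
    using braid_eq.cancel[of n "[(False, j), (True, i), (True, j)]" "(True, i)" "[]"] by simp
  finally show ?thesis .
qed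

lemma braid_rel_mixed2:
  "braid_eq n [(True, i), (False, j), (False, i)] [(False, j), (False, i), (True, j)]"
proof -
  have "braid_eq n [(True, i), (False, j), (False, i)]
      [(True, i), (False, j), (False, i), (False, j), (True, j)]"
    using braid_eq.cancel[of n "[(True, i), (False, j), (False, i)]" "(False, j)" "[]"]
    by (auto intro: braid_eq.sym)
  also have "braid_eq n \<dots> [(True, i), (False, i), (False, j), (False, i), (True, j)]"
    using braid_eq_cong[OF braid_eq.sym[OF braid_rel_neg], of "[(True, i)]" "[(True, j)]"] by simp
  also have "braid_eq n \<dots> [(False, j), (False, i), (True, j)]"
    using braid_eq.cancel[of n "[]" "(True, i)"] by simp
  finally show ?thesis .
qed

end

section \<open>The cyclic Hurwitz action on tuples\<close>

locale annulus =
  fixes n :: nat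
  assumes n_ge_2: "2 \<le> n"
begin

lemma nxt_in: "i \<in> {1..n} \<Longrightarrow> nxt n i \<in> {1..n}"
  using n_ge_2 by (auto simp: nxt_def)

lemma nxt_neq: "nxt n i \<noteq> i"
  using n_ge_2 by (auto simp: nxt_def)

lemma nxt_inj: "i \<in> {1..n} \<Longrightarrow> j \<in> {1..n} \<Longrightarrow> nxt n i = nxt n j \<longleftrightarrow> i = j"
  using n_ge_2 by (auto simp: nxt_def)

lemma nxt_nxt_neq: "3 \<le> n \<Longrightarrow> i \<in> {1..n} \<Longrightarrow> nxt n (nxt n i) \<noteq> i"
  by (auto simp: nxt_def)

fun move :: "letter \<Rightarrow> (nat \<Rightarrow> freegrp) \<Rightarrow> (nat \<Rightarrow> freegrp)" where
  "move (True, i) y = y(i := conj_by True (y i) (y (nxt n i)), nxt n i := y i)"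
| "move (False, i) y = y(i := y (nxt n i), nxt n i := conj_by False (y (nxt n i)) (y i))"

lemma conj_by_cancel [simp]: "conj_by (\<not> b) g (conj_by b g h) = h" "conj_by False g (conj_by True g h) = h"
  "conj_by True g (conj_by False g h) = h"
  unfolding conj_by_def by (cases b; simp only: group_simps if_True if_False simp_thms)+

lemma move_inv [simp]: "move (inv_letter a) (move a y) = y"
  using nxt_neq[of "snd a"] by (cases "(a, y)" rule: move.cases) (auto simp: fun_eq_iff)

lemma moves_inv_word: "fold move (inv_word u) (fold move u y) = y"
  by (induction u arbitrary: y) simp_all

lemma ghom_conj_by: "ghom f (conj_by b g h) = conj_by b (ghom f g) (ghom f h)"
  unfolding conj_by_def by (cases b) (simp_all only: group_simps ghom_add ghom_uminus if_True if_False)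

text \<open>Moves are written with group operations only, hence commute with homomorphisms. This is
  why composing automorphisms along a word amounts to applying the moves to \<open>X\<close> in the
  order of its letters.\<close>

lemma ghom_move: "move a (\<lambda>k. ghom f (y k)) = (\<lambda>k. ghom f (move a y k))"
  by (cases "(a, y)" rule: move.cases) (auto simp: fun_eq_iff ghom_conj_by)

lemma ghom_moves: "fold move u (\<lambda>k. ghom f (y k)) = (\<lambda>k. ghom f (fold move u y k))"
  by (induction u arbitrary: y) (simp_all add: ghom_move)

lemma elt_rho_gen: "i \<in> {1..n} \<Longrightarrow> elt (rho_gen n (b, i) k) = move (b, i) X k"
  using n_ge_2
  by (cases b)
    (auto simp: rho_gen_def nxt_def conj_by_def elt_letter elt_Cons[of _ "[_]"] elt_Cons[of _ "[_, _]"] add_diff_eq simp flip: add.assoc)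

lemma elt_rho_word: "u \<in> sigma_words n \<Longrightarrow> (\<lambda>k. elt (rho_word n u k)) = fold move u X"
proof (induction u)
  case Nil
  then show ?case
    by (simp add: X_def)
next
  case (Cons a u)
  then have IH: "elt (rho_word n u k) = fold move u X k" for k
    by (auto simp: sigma_words_def dest: fun_cong)
  have gen: "(\<lambda>k. elt (rho_gen n a k)) = move a X"
    using Cons.prems by (cases a) (auto simp: sigma_words_def elt_rho_gen)
  show ?case
    by (simp add: compose_def elt_subst IH gen flip: ghom_moves)
qed

lemma reduced_rho_word: "reduced (rho_word n u k)"
  by (cases u) (simp_all add: compose_def subst_def reduced_red)

lemma rho_word_eq_rep: "u \<in> sigma_words n \<Longrightarrow> rho_word n u k = rep (fold move u X k)"
  using fun_cong[OF elt_rho_word, of u k] by (metis rep_elt_reduced reduced_rho_word)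

lemma move_outside: "a \<in> {1..n} \<Longrightarrow> k \<notin> {1..n} \<Longrightarrow> move (b, a) y k = y k"
  using nxt_in[of a] by (cases b) auto

lemma sigma_words_Cons [simp]: "(b, i) # u \<in> sigma_words n \<longleftrightarrow> i \<in> {1..n} \<and> u \<in> sigma_words n"
  by (auto simp: sigma_words_def)

lemma sigma_words_Nil [simp]: "[] \<in> sigma_words n"
  by (simp add: sigma_words_def)

lemma sigma_words_append [simp]:
  "u @ v \<in> sigma_words n \<longleftrightarrow> u \<in> sigma_words n \<and> v \<in> sigma_words n"
  by (auto simp: sigma_words_def)

lemma sigma_words_inv_word: "u \<in> sigma_words n \<Longrightarrow> inv_word u \<in> sigma_words n"
  by (induction u) (auto simp: sigma_words_def)

lemma moves_outside: "u \<in> sigma_words n \<Longrightarrow> k \<notin> {1..n} \<Longrightarrow> fold move u y k = y k"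
proof (induction u arbitrary: y)
  case (Cons a u)
  then show ?case
    by (cases a) (simp add: move_outside)
qed simp

definition boundary :: "(nat \<Rightarrow> freegrp) \<Rightarrow> freegrp" where
  "boundary y = sum_list (map y [1..<Suc n])"

definition conj_tuple :: "(nat \<Rightarrow> nat) \<Rightarrow> (nat \<Rightarrow> freegrp) \<Rightarrow> bool" where
  "conj_tuple c y \<longleftrightarrow> c permutes {1..n} \<and> (\<forall>i\<in>{1..n}. \<exists>g\<in>Fsub n. y i = g + X (c i) - g)"

text \<open>The condition of the image theorem, stated for the tuple of images. Entries outside
  \<open>{1..n}\<close> are frozen so that equality of tuples is equality of functions.\<close>

definition admissible :: "(nat \<Rightarrow> freegrp) \<Rightarrow> bool" where
  "admissible y \<longleftrightarrow> (\<exists>c. conj_tuple c y) \<and> (\<forall>k. k \<notin> {1..n} \<longrightarrow> y k = X k) \<and>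
     (\<exists>g\<in>Fsub n. glen0 g = 0 \<and> boundary y = g + boundary X - g)"

lemma admissible_X: "admissible X"
proof -
  have "conj_tuple id X"
    by (auto simp: conj_tuple_def permutes_id intro!: bexI[of _ 0])
  then show ?thesis
    by (auto simp: admissible_def glen0_def intro!: bexI[of _ 0])
qed

lemma conj_tuple_Fsub:
  assumes "conj_tuple c y" "i \<in> {1..n}"
  shows "y i \<in> Fsub n"
proof -
  have "c i \<in> {1..n}"
    using assms by (metis conj_tuple_def permutes_in_image)
  then show ?thesis
    using assms unfolding conj_tuple_def diff_conv_add_uminus
    by (metis Fsub_X Fsub_add Fsub_uminus)
qed

lemma conj_tuple_glen0: "conj_tuple c y \<Longrightarrow> i \<in> {1..n} \<Longrightarrow> glen0 (y i) = 1"
  by (auto simp: conj_tuple_def dest!: bspec[of _ _ i])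

lemma conj_tuple_move:
  assumes "conj_tuple c y" "i \<in> {1..n}"
  shows "conj_tuple (c \<circ> transpose i (nxt n i)) (move (b, i) y)"
proof -
  let ?j = "nxt n i"
  have j: "?j \<in> {1..n}" "?j \<noteq> i"
    using assms(2) nxt_in nxt_neq by auto
  have "c \<circ> transpose i ?j permutes {1..n}"
    using permutes_compose[OF permutes_swap_id[OF assms(2) j(1)]] assms(1)
    by (simp add: conj_tuple_def)
  moreover have "\<exists>g\<in>Fsub n. conj_by d (y p) (y q) = g + X (c q) - g"
    if pq: "p \<in> {1..n}" "q \<in> {1..n}" for d p q
  proof -
    obtain g where g: "g \<in> Fsub n" "y q = g + X (c q) - g"
      using assms pq unfolding conj_tuple_def by blast
    have "y p \<in> Fsub n"
      using conj_tuple_Fsub assms pq by blast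
    then have "(if d then y p else - y p) + g \<in> Fsub n"
      using g by (auto intro: Fsub_add Fsub_uminus)
    moreover have "conj_by d (y p) (y q)
        = ((if d then y p else - y p) + g) + X (c q) - ((if d then y p else - y p) + g)"
      unfolding conj_by_def g(2) by (cases d) (simp_all only: group_simps if_True if_False)
    ultimately show ?thesis
      by blast
  qed
  ultimately show ?thesis
    using assms j by (cases b) (auto simp: conj_tuple_def transpose_def)
qed

lemma boundary_split:
  assumes "i \<in> {1..<n}"
  shows "boundary y = sum_list (map y [1..<i]) + (y i + (y (Suc i) + sum_list (map y [Suc (Suc i)..<Suc n])))"
proof -
  have "[1..<Suc n] = [1..<i] @ i # Suc i # [Suc (Suc i)..<Suc n]"
    using assms upt_add_eq_append[of 1 i "Suc n - i"] by (simp add: upt_conv_Cons del: upt_Suc)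
  then show ?thesis
    unfolding boundary_def by (simp del: upt_Suc add: add.assoc)
qed

lemma boundary_ends: "boundary y = y 1 + (sum_list (map y [2..<n]) + y n)"
proof -
  have "[1..<Suc n] = 1 # [2..<n] @ [n]"
    using n_ge_2 by (simp add: upt_conv_Cons numeral_2_eq_2)
  then show ?thesis
    unfolding boundary_def by (simp del: upt_Suc add: add.assoc)
qed

lemma boundary_move: "i \<in> {1..<n} \<Longrightarrow> boundary (move (b, i) y) = boundary y"
  unfolding boundary_split
  by (cases b) (simp_all add: nxt_def conj_by_def del: upt_Suc, simp_all only: group_simps simp_thms)

text \<open>Only the move across the ends of the product changes it. The conjugator is a quotient of
  two entries of algebraic length 1, which is the origin of the condition of algebraic length
  0.\<close>

lemma boundary_move_last:
  fixes y b
  defines "h \<equiv> (if b then y n - y 1 else - y 1 + y n)"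
  shows "boundary (move (b, n) y) = h + boundary y - h"
proof -
  have "map (move (b, n) y) [2..<n] = map y [2..<n]"
    by (cases b) (auto simp: nxt_def)
  then show ?thesis
    unfolding boundary_ends h_def using n_ge_2
    by (cases b) (simp_all add: nxt_def conj_by_def del: upt_Suc, simp_all only: group_simps simp_thms)
qed

lemma admissible_move:
  assumes y: "admissible y" and i: "i \<in> {1..n}"
  shows "admissible (move (b, i) y)"
proof -
  obtain c g where c: "conj_tuple c y" and g: "g \<in> Fsub n" "glen0 g = 0"
      "boundary y = g + boundary X - g"
    using y by (auto simp: admissible_def)
  have "\<exists>g\<in>Fsub n. glen0 g = 0 \<and> boundary (move (b, i) y) = g + boundary X - g"
  proof (cases "i = n")
    case False
    then show ?thesis
      using g i boundary_move[of i b y] by (intro bexI[of _ g]) auto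
  next
    case True
    define h where "h = (if b then y n - y 1 else - y 1 + y n)"
    have n1: "1 \<in> {1..n}" "n \<in> {1..n}"
      using n_ge_2 by auto
    have "h \<in> Fsub n"
      unfolding h_def diff_conv_add_uminus
      using conj_tuple_Fsub[OF c n1(1)] conj_tuple_Fsub[OF c n1(2)]
      by (cases b) (simp_all only: if_True if_False Fsub_add Fsub_uminus)
    moreover have "glen0 h = 0"
      using conj_tuple_glen0[OF c] n1 by (auto simp: h_def)
    moreover have "boundary (move (b, i) y) = (h + g) + boundary X - (h + g)"
      unfolding True boundary_move_last h_def[symmetric] g(3) by (simp only: group_simps)
    ultimately show ?thesis
      using g by (intro bexI[of _ "h + g"]) (auto intro: Fsub_add)
  qed
  then show ?thesis
    using conj_tuple_move[OF c i] move_outside[OF i] y by (auto simp: admissible_def)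
qed

lemma admissible_moves: "u \<in> sigma_words n \<Longrightarrow> admissible y \<Longrightarrow> admissible (fold move u y)"
proof (induction u arbitrary: y)
  case (Cons a u)
  then show ?case
    by (cases a) (simp add: admissible_move)
qed simp


section \<open>Descents\<close>

definition height :: "(nat \<Rightarrow> freegrp) \<Rightarrow> nat" where
  "height y = (\<Sum>k\<in>{1..n}. glen (y k))"

lemma height_upd2:
  assumes "i \<in> {1..n}" "j \<in> {1..n}" "i \<noteq> j"
  shows "height (y(i := a, j := b)) + (glen (y i) + glen (y j)) = height y + (glen a + glen b)"
proof -
  have split: "height z = glen (z i) + (glen (z j) + (\<Sum>k\<in>{1..n} - {i} - {j}. glen (z k)))" for z
    using assms by (simp add: height_def sum.remove[of _ i] sum.remove[of _ j])
  have "(\<Sum>k\<in>{1..n} - {i} - {j}. glen ((y(i := a, j := b)) k)) = (\<Sum>k\<in>{1..n} - {i} - {j}. glen (y k))"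
    by (rule sum.cong) auto
  then show ?thesis
    using assms by (simp add: split)
qed

definition descends :: "letter \<Rightarrow> (nat \<Rightarrow> freegrp) \<Rightarrow> bool" where
  "descends a y \<longleftrightarrow> height (move a y) < height y"

definition normal_data :: "(nat \<Rightarrow> nat) \<Rightarrow> (nat \<Rightarrow> word) \<Rightarrow> (nat \<Rightarrow> freegrp) \<Rightarrow> bool" where
  "normal_data c w y \<longleftrightarrow> c permutes {1..n} \<and>
     (\<forall>i\<in>{1..n}. good (c i) (w i) \<and> snd ` set (w i) \<subseteq> {1..n} \<and> y i = conj_gen (w i) (c i))"

lemma admissible_normal_data:
  assumes "admissible y"
  shows "\<exists>c w. normal_data c w y"
proof -
  obtain c where c: "conj_tuple c y"
    using assms by (auto simp: admissible_def)
  have "\<exists>w. good (c i) w \<and> snd ` set w \<subseteq> {1..n} \<and> y i = conj_gen w (c i)" if i: "i \<in> {1..n}" for i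
  proof -
    obtain g where g: "g \<in> Fsub n" "y i = g + X (c i) - g"
      using c i unfolding conj_tuple_def by blast
    obtain w z where "rep g = w @ z" "good (c i) w" "conj_gen (rep g) (c i) = conj_gen w (c i)"
      using good_strip[of "rep g" "c i"] by auto
    moreover have "y i = conj_gen (rep g) (c i)"
      by (simp add: conj_gen_def g)
    ultimately show ?thesis
      using g by (intro exI[of _ w]) (auto simp: Fsub_iff)
  qed
  then obtain w where "\<forall>i\<in>{1..n}. good (c i) (w i) \<and> snd ` set (w i) \<subseteq> {1..n} \<and> y i = conj_gen (w i) (c i)"
    by metis
  then show ?thesis
    using c unfolding normal_data_def conj_tuple_def by blast
qed

lemma normal_data_neq: "normal_data c w y \<Longrightarrow> i \<in> {1..n} \<Longrightarrow> j \<in> {1..n} \<Longrightarrow> i \<noteq> j \<Longrightarrow> c i \<noteq> c j"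
  by (auto simp: normal_data_def dest: permutes_inj injD)

text \<open>A move carries one of its two entries over unchanged, so the heights differ as the
  length of the conjugated entry does before and after; \<open>conj_by_shorter\<close> and
  \<open>conj_by_longer\<close> decide the sign, and no tie is left.\<close>

lemma descends_cases:
  assumes d: "normal_data c w y" and i: "i \<in> {1..n}"
  defines "j \<equiv> nxt n i"
  shows "descends (True, i) y \<longleftrightarrow> prefix (w i @ [(False, c i)]) (w j)"
    and "descends (False, i) y \<longleftrightarrow> prefix (w j @ [(True, c j)]) (w i)"
    and "\<not> descends (b, i) y \<Longrightarrow> height y < height (move (b, i) y)"
proof -
  have j: "j \<in> {1..n}" "i \<noteq> j"
    using i nxt_in nxt_neq[of i] by (auto simp: j_def)
  note ij = d[unfolded normal_data_def, THEN conjunct2, rule_format, OF i]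
    d[unfolded normal_data_def, THEN conjunct2, rule_format, OF j(1)]
  have c: "c i \<noteq> c j" "c j \<noteq> c i"
    using normal_data_neq[OF d i j] by auto
  have pos: "height (move (True, i) y) + glen (y j) = height y + glen (conj_by True (y i) (y j))"
    using height_upd2[OF i j, of y "conj_by True (y i) (y j)" "y i"] by (simp add: j_def)
  have neg: "height (move (False, i) y) + glen (y i) = height y + glen (conj_by False (y j) (y i))"
    using height_upd2[OF i j, of y "y j" "conj_by False (y j) (y i)"] by (simp add: j_def)
  have pos': "if prefix (w i @ [(False, c i)]) (w j) then glen (conj_by True (y i) (y j)) < glen (y j)
      else glen (y j) < glen (conj_by True (y i) (y j))"
    using conj_by_shorter[of "c j" "w j" "w i" True "c i"] conj_by_longer[of "c i" "w i" "c j" "w j" True] ij c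
    by auto
  have neg': "if prefix (w j @ [(True, c j)]) (w i) then glen (conj_by False (y j) (y i)) < glen (y i)
      else glen (y i) < glen (conj_by False (y j) (y i))"
    using conj_by_shorter[of "c i" "w i" "w j" False "c j"] conj_by_longer[of "c j" "w j" "c i" "w i" False] ij c
    by auto
  show "descends (True, i) y \<longleftrightarrow> prefix (w i @ [(False, c i)]) (w j)"
    unfolding descends_def using pos pos' by (auto split: if_splits)
  show "descends (False, i) y \<longleftrightarrow> prefix (w j @ [(True, c j)]) (w i)"
    unfolding descends_def using neg neg' by (auto split: if_splits)
  show "\<not> descends (b, i) y \<Longrightarrow> height y < height (move (b, i) y)"
    unfolding descends_def using pos pos' neg neg' by (cases b) (auto split: if_splits)
qed

section \<open>Tuples without descents\<close>

definition cyc :: "nat \<Rightarrow> nat" where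
  "cyc k = Suc (k mod n)"

lemma cyc_in: "cyc k \<in> {1..n}"
  using n_ge_2 by (simp add: cyc_def Suc_le_eq)

lemma nxt_cyc: "nxt n (cyc k) = cyc (Suc k)"
  by (simp add: cyc_def nxt_def mod_Suc)

lemma cyc_less: "k < n \<Longrightarrow> cyc k = Suc k"
  by (simp add: cyc_def)

lemma map_cyc: "map (\<lambda>k. f (cyc k)) [0..<n] = map f [1..<Suc n]"
proof -
  have "map f [1..<Suc n] = map (\<lambda>k. f (Suc k)) [0..<n]"
    by (simp add: map_Suc_upt[symmetric] comp_def del: upt_Suc)
  then show ?thesis
    by (simp add: cyc_less)
qed

lemma concat_replicate_periodic:
  assumes "\<And>k. B (k + n) = B k"
  shows "concat (replicate m (concat (map B [0..<n]))) = concat (map B [0..<m * n])"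
proof (induction m)
  case (Suc m)
  have "B (k + m * n) = B k" for k m
    by (induction m) (use assms[of "k + _ * n"] in \<open>simp_all add: ac_simps\<close>)
  then have 1: "map B [m * n..<m * n + n] = map B [0..<n]"
    by (intro nth_equalityI) (simp_all add: add.commute)
  have 2: "[0..<Suc m * n] = [0..<m * n] @ [m * n..<m * n + n]"
    using upt_add_eq_append[of 0 "m * n" n] by (simp add: add.commute)
  have 3: "concat (replicate (Suc m) C) = concat (replicate m C) @ C" for C :: "'b list"
  proof -
    have "concat (replicate (Suc m) C) = concat (replicate m C @ [C])"
      by (simp only: replicate_append_same replicate_Suc)
    then show ?thesis
      by simp
  qed
  show ?case
    unfolding 2 3 Suc map_append concat_append 1 ..
qed simp

lemma no_descent_eq_X:
  assumes y: "admissible y" and nodesc: "\<And>b i. i \<in> {1..n} \<Longrightarrow> \<not> descends (b, i) y"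
  shows "y = X"
proof -
  obtain c w where d: "normal_data c w y"
    using admissible_normal_data[OF y] by auto
  obtain g where g: "glen0 g = 0" "boundary y = g + boundary X - g"
    using y by (auto simp: admissible_def)
  have c: "c permutes {1..n}"
    using d by (simp add: normal_data_def)
  have dat: "good (c i) (w i)" "snd ` set (w i) \<subseteq> {1..n}" "y i = conj_gen (w i) (c i)"
    if "i \<in> {1..n}" for i
    using d that by (auto simp: normal_data_def)
  \<comment> \<open>The product of the entries telescopes into blocks \<open>B k\<close>: the marked
    letter x_{c(k)} followed by the reduced gap w_k^-1 w_{k+1}. The index runs on periodically so
    that powers of the cyclic word \<open>C\<close> are covered too.\<close>
  define v where "v k = rep (- elt (w (cyc k)) + elt (w (cyc (Suc k))))" for k
  define B where "B k = (True, c (cyc k)) # v k" for k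
  define C where "C = concat (map B [0..<n])"
  have length_B: "length (B k) = Suc (length (v k))" for k
    by (simp add: B_def)
  have step: "reduced (B k @ [hd (B (Suc k))])" for k
    using reduced_gap[OF dat(1)[OF cyc_in[of k]] dat(1)[OF cyc_in[of "Suc k"]]]
      nodesc[OF cyc_in[of k]] descends_cases[OF d cyc_in[of k]]
    by (simp add: B_def v_def nxt_cyc)
  \<comment> \<open>The first letter of the next block is carried along: it is the overlap at which
    \<open>reduced_glue\<close> joins the blocks.\<close>
  have red: "reduced (concat (map B [0..<N]) @ [hd (B N)])" for N
  proof (induction N)
    case (Suc N)
    have "reduced ([hd (B N)] @ v N @ [hd (B (Suc N))])"
      using step[of N] by (simp add: B_def)
    from reduced_glue[OF Suc this] show ?case
      by (simp add: B_def)
  qed simp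
  have "B (k + n) = B k" for k
    by (simp add: B_def v_def cyc_def mod_Suc)
  then have pow: "concat (replicate m C) = concat (map B [0..<m * n])" for m
    unfolding C_def by (rule concat_replicate_periodic)
  have red_pow: "reduced (concat (replicate m C))" for m
    using red[of "m * n"] by (simp add: pow reduced_append)
  \<comment> \<open>After one full turn both outer conjugators are w_1, so \<open>C\<close> is a
    conjugate of the boundary.\<close>
  have "elt (concat (map B [0..<N])) =
      - elt (w (cyc 0)) + sum_list (map (\<lambda>k. y (cyc k)) [0..<N]) + elt (w (cyc N))" for N
  proof (induction N)
    case (Suc N)
    have "elt (B N) = X (c (cyc N)) + elt (v N)"
      using elt_Cons[of "(True, c (cyc N))" "v N"] by (simp add: B_def X_def)
    then have "elt (B N) = - elt (w (cyc N)) + y (cyc N) + elt (w (cyc (Suc N)))"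
      unfolding v_def elt_rep dat(3)[OF cyc_in] conj_gen_def by (simp only: group_simps)
    then show ?case
      by (simp add: elt_append Suc) (simp only: group_simps)
  qed simp
  from this[of n] have "elt C = - elt (w (cyc 0)) + boundary y + elt (w (cyc n))"
    unfolding C_def map_cyc boundary_def .
  then have "elt C = (- elt (w (cyc 0)) + g) + boundary X - (- elt (w (cyc 0)) + g)"
    unfolding g(2) by (simp only: group_simps) (simp add: cyc_def)
  then have "length C \<le> glen (boundary X)"
    using cyclically_reduced_minimal[OF red_pow] by blast
  moreover have boundary_pos: "boundary (\<lambda>i. X (f i)) = elt (pos (map f [1..<Suc n]))" for f
  proof -
    have "sum_list (map (\<lambda>i. X (f i)) xs) = elt (pos (map f xs))" for xs
    proof (induction xs)
      case (Cons x xs)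
      then show ?case
        using elt_Cons[of "(True, f x)" "pos (map f xs)"] by (simp add: X_def)
    qed simp
    then show ?thesis
      by (simp add: boundary_def)
  qed
  ultimately have len_C: "length C \<le> n"
    using boundary_pos[of id] glen_elt_le[of "pos [1..<Suc n]"] by (simp del: upt_Suc)
  have len_B: "k < N \<Longrightarrow> N + length (v k) \<le> length (concat (map B [0..<N]))" for k N
  proof (induction N)
    case (Suc N)
    have "N \<le> length (concat (map B [0..<N]))"
      by (induction N) (simp_all add: length_B)
    then show ?case
      using Suc by (cases "k = N") (simp_all add: length_B)
  qed simp
  \<comment> \<open>The n blocks have at least one letter each and at most n letters in all, so no
    room is left for a gap.\<close>
  have v_Nil: "v k = []" if "k < n" for k
  proof -
    have "length (v k) = 0"
      using len_C len_B[OF that] unfolding C_def by linarith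
    then show ?thesis
      by simp
  qed
  have "k < n \<Longrightarrow> w (cyc k) = w (cyc 0)" for k
  proof (induction k)
    case (Suc k)
    then have "- elt (w (cyc k)) + elt (w (cyc (Suc k))) = 0"
      using v_Nil[of k] by (simp add: v_def)
    then have "elt (w (cyc (Suc k))) = elt (w (cyc k))"
      using neg_eq_iff_add_eq_0[of "- elt (w (cyc k))" "elt (w (cyc (Suc k)))"] by simp
    then show ?case
      using Suc dat(1)[OF cyc_in[of k]] dat(1)[OF cyc_in[of "Suc k"]]
      by (auto simp: good_def elt_eq_iff red_reduced)
  qed simp
  note w_cyc = this
  have w_const: "w i = w 1" if "i \<in> {1..n}" for i
  proof -
    have "i - 1 < n" "cyc (i - 1) = i" "cyc 0 = 1"
      using that by (auto simp: cyc_def)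
    then show ?thesis
      using w_cyc by metis
  qed
  \<comment> \<open>The index of the last letter of the common word is c(i) for some i, since c is a
    permutation; at that i the word would not be \<open>good\<close>.\<close>
  have w1: "w 1 = []"
  proof (rule ccontr)
    assume nonempty: "w 1 \<noteq> []"
    then have "snd (last (w 1)) \<in> snd ` set (w 1)"
      by simp
    moreover have "1 \<in> {1..n}"
      using n_ge_2 by simp
    ultimately have "snd (last (w 1)) \<in> {1..n}"
      using dat(2) by blast
    then obtain i where i: "i \<in> {1..n}" "c i = snd (last (w 1))"
      using permutes_image[OF c] by (metis imageE)
    then show False
      using dat(1)[OF i(1)] w_const[OF i(1)] nonempty by (auto simp: good_def)
  qed
  have yc: "y i = X (c i)" if "i \<in> {1..n}" for i
    using dat(3)[OF that] w_const[OF that] w1 by (simp add: conj_gen_def)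
  then have "boundary y = boundary (\<lambda>i. X (c i))"
    unfolding boundary_def by (intro arg_cong[of _ _ sum_list] map_cong) auto
  then have "elt (pos (map c [1..<Suc n])) = g + elt (pos (map id [1..<Suc n])) - g"
    using g(2) boundary_pos[of c] boundary_pos[of id] by simp
  from conjugate_positive_words[OF _ _ this] obtain k where
    k: "map c [1..<Suc n] = rotate k [1..<Suc n]" "int n dvd int k"
    using n_ge_2 g(1) by (auto simp del: upt_Suc)
  \<comment> \<open>Algebraic length 0 makes the rotation a multiple of n, hence the
    identity.\<close>
  then have "rotate k [1..<Suc n] = [1..<Suc n]"
    using rotate_id[of k "[1..<Suc n]"] by (simp add: zmod_int[symmetric] dvd_eq_mod_eq_0 del: upt_Suc)
  then have "map c [1..<Suc n] = map id [1..<Suc n]"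
    using k by simp
  then have "c i = i" if "i \<in> {1..n}" for i
  proof -
    have "i \<in> set [1..<Suc n]"
      using that by auto
    then show ?thesis
      using \<open>map c [1..<Suc n] = map id [1..<Suc n]\<close> unfolding map_eq_conv by (metis id_apply)
  qed
  then have "y i = X i" for i
    using yc y by (cases "i \<in> {1..n}") (auto simp: admissible_def)
  then show ?thesis
    by auto
qed

lemma no_descent_X: "i \<in> {1..n} \<Longrightarrow> \<not> descends (b, i) X"
proof -
  have "normal_data id (\<lambda>_. []) X"
    by (auto simp: normal_data_def good_def conj_gen_def permutes_id)
  then show "i \<in> {1..n} \<Longrightarrow> \<not> descends (b, i) X"
    using descends_cases(1,2)[of id "\<lambda>_. []" X i] by (cases b) auto
qed

lemma admissible_reach: "admissible y \<Longrightarrow> \<exists>u\<in>sigma_words n. fold move u y = X"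
proof (induction "height y" arbitrary: y rule: less_induct)
  case less
  show ?case
  proof (cases "y = X")
    case True
    then show ?thesis
      by (intro bexI[of _ "[]"]) simp_all
  next
    case False
    then obtain b i where i: "i \<in> {1..n}" "descends (b, i) y"
      using no_descent_eq_X[OF less.prems] by blast
    then obtain u where "u \<in> sigma_words n" "fold move u (move (b, i) y) = X"
      using less.hyps[of "move (b, i) y"] admissible_move[OF less.prems i(1)]
      by (auto simp: descends_def)
    then show ?thesis
      using i by (intro bexI[of _ "(b, i) # u"]) simp_all
  qed
qed

end

section \<open>The polygon invariant and ping-pong\<close>

text \<open>The oriented area form on the real plane underlying \<open>complex\<close>; its sign
  records on which side of the line of u the vector v lies.\<close>

definition dt :: "complex \<Rightarrow> complex \<Rightarrow> real" where
  "dt u v = Re u * Im v - Im u * Re v"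

lemma dt_simps [simp]:
  "dt (u + v) w = dt u w + dt v w" "dt w (u + v) = dt w u + dt w v"
  "dt (u - v) w = dt u w - dt v w" "dt w (u - v) = dt w u - dt w v"
  "dt (- u) w = - dt u w" "dt w (- u) = - dt w u"
  "dt (r *\<^sub>R u) w = r * dt u w" "dt w (r *\<^sub>R u) = r * dt w u" "dt u u = 0"
  by (simp_all add: dt_def algebra_simps)

lemma dt_swap: "dt v u = - dt u v"
  by (simp add: dt_def)

lemma dt_basis:
  assumes "dt u v \<noteq> 0"
  shows "w = (dt w v / dt u v) *\<^sub>R u + (dt u w / dt u v) *\<^sub>R v"
proof -
  have "dt u v *\<^sub>R w = dt w v *\<^sub>R u + dt u w *\<^sub>R v"
    by (simp add: dt_def complex_eq_iff algebra_simps)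
  then have "(1 / dt u v) *\<^sub>R (dt u v *\<^sub>R w) = (1 / dt u v) *\<^sub>R (dt w v *\<^sub>R u + dt u w *\<^sub>R v)"
    by simp
  then show ?thesis
    using assms by (simp add: scaleR_add_right divide_inverse mult.commute)
qed

section \<open>The action by transvections\<close>

context annulus
begin

text \<open>The vertices of the regular 2n-gon. As \<open>H0 (j + n)\<close> is the negative of
  \<open>H0 j\<close>, their lines cut the projective line into n arcs, one for each
  generator.\<close>

definition H0 :: "int \<Rightarrow> complex" where
  "H0 j = cis (pi * j / n)"

lemma dt_H0: "dt (H0 i) (H0 j) = sin (pi * (j - i) / n)"
  by (simp add: H0_def dt_def sin_diff diff_divide_distrib right_diff_distrib)

definition cusp :: "int \<Rightarrow> complex" where
  "cusp j = H0 j + H0 (j + 1)"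

text \<open>The generator \<open>x\<^sub>k\<close> acts as the transvection that fixes \<open>cusp k\<close> and sends
  \<open>H0 (k + 1)\<close> to \<open>- H0 k\<close>.\<close>

definition act_letter :: "letter \<Rightarrow> complex \<Rightarrow> complex" where
  "act_letter a v =
     v + ((if fst a then - 1 else 1) / sin (pi / n) * dt (cusp (int (snd a))) v) *\<^sub>R cusp (int (snd a))"

definition act :: "freegrp \<Rightarrow> complex \<Rightarrow> complex" where
  "act g = foldr act_letter (rep g)"

lemma act_letter_inv: "act_letter a (act_letter (inv_letter a) v) = v"
  by (cases a) (simp add: act_letter_def algebra_simps)

lemma act_elt: "act (elt w) v = foldr act_letter w v"
  by (simp add: act_def rep_elt foldr_red act_letter_inv)

lemma act_add: "act (g + h) v = act g (act h v)"
  using act_elt[of "rep g @ rep h" v] by (simp add: act_def plus_freegrp_def)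

lemma act_0 [simp]: "act 0 v = v"
  by (simp add: act_def)

lemma act_uminus_cancel [simp]: "act (- g) (act g v) = v" "act g (act (- g) v) = v"
  by (simp_all flip: act_add)

lemma act_letter_linear: "act_letter a (r *\<^sub>R u + s *\<^sub>R v) = r *\<^sub>R act_letter a u + s *\<^sub>R act_letter a v"
  by (simp add: act_letter_def algebra_simps)

lemma act_linear: "act g (r *\<^sub>R u + s *\<^sub>R v) = r *\<^sub>R act g u + s *\<^sub>R act g v"
proof -
  have "foldr act_letter w (r *\<^sub>R u + s *\<^sub>R v) = r *\<^sub>R foldr act_letter w u + s *\<^sub>R foldr act_letter w v" for w
    by (induction w) (simp_all add: act_letter_linear)
  then show ?thesis
    by (simp add: act_def)
qed

lemma act_simps [simp]:
  "act g (u + v) = act g u + act g v" "act g (- u) = - act g u" "act g (u - v) = act g u - act g v"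
  "act g (r *\<^sub>R u) = r *\<^sub>R act g u"
  using act_linear[of g 1 u 1 v] act_linear[of g "-1" u 0 v] act_linear[of g 1 u "-1" v]
    act_linear[of g r u 0 v] by simp_all

lemma act_numeral [simp]: "act g (numeral k * v) = numeral k * act g v"
  using act_simps(4)[of g "numeral k" v] by (simp add: scaleR_conv_of_real)

lemma dt_act_letter: "dt (act_letter a u) (act_letter a v) = dt u v"
  by (simp add: act_letter_def dt_swap[of _ "cusp _"] algebra_simps)

lemma dt_act [simp]: "dt (act g u) (act g v) = dt u v"
proof -
  have "dt (foldr act_letter w u) (foldr act_letter w v) = dt u v" for w
    by (induction w) (simp_all add: dt_act_letter)
  then show ?thesis
    by (simp add: act_def)
qed

lemma act_X: "act (X k) v = act_letter (True, k) v"
  by (simp add: X_def act_elt)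

section \<open>Centrally symmetric polygons under Hurwitz moves\<close>

definition polygon :: "(int \<Rightarrow> complex) \<Rightarrow> bool" where
  "polygon H \<longleftrightarrow> (\<forall>j. H (j + int n) = - H j) \<and> (\<forall>i j. i < j \<longrightarrow> j < i + int n \<longrightarrow> 0 < dt (H i) (H j))"

lemma polygon_shift:
  assumes "polygon H"
  shows "H (j + m * int n) = (if even m then H j else - H j)"
proof (induction m rule: int_induct[of _ 0])
  case (step1 m)
  have "H (j + (m + 1) * int n) = - H (j + m * int n)"
    using assms unfolding polygon_def by (metis distrib_right add.assoc mult_1)
  with step1 show ?case
    by auto
next
  case (step2 m)
  have "H (j + m * int n) = - H (j + (m - 1) * int n)"
    using assms unfolding polygon_def
    by (metis (no_types, opaque_lifting) distrib_right add.assoc mult_1 diff_add_cancel)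
  with step2 show ?case
    by (auto simp: minus_equation_iff[of "H (j + (m - 1) * int n)"])
qed simp

lemma polygon_nonneg:
  assumes "polygon H" "i \<le> j" "j \<le> i + int n"
  shows "0 \<le> dt (H i) (H j)"
proof -
  consider "j = i" | "j = i + int n" | "i < j" "j < i + int n"
    using assms by linarith
  then show ?thesis
    using assms(1) unfolding polygon_def by cases (auto intro: less_imp_le)
qed

lemma polygon_pos: "polygon H \<Longrightarrow> i < j \<Longrightarrow> j < i + int n \<Longrightarrow> 0 < dt (H i) (H j)"
  by (simp add: polygon_def)

lemma polygon_H0: "polygon H0"
proof -
  have "H0 (j + int n) = - H0 j" for j
    using n_ge_2 by (simp add: H0_def distrib_left add_divide_distrib flip: cis_mult)
  moreover have "0 < dt (H0 i) (H0 j)" if "i < j" "j < i + int n" for i j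
  proof -
    define t where "t = real_of_int (j - i) / real n"
    have "real_of_int (j - i) < real n" "0 < real_of_int (j - i)"
      using that by linarith+
    then have "0 < t" "t < 1"
      using n_ge_2 by (auto simp: t_def)
    then have "0 < sin (pi * t)"
      by (intro sin_gt_zero) auto
    then show ?thesis
      unfolding dt_H0 t_def by simp
  qed
  ultimately show ?thesis
    by (simp add: polygon_def)
qed

definition ix :: "int \<Rightarrow> nat" where
  "ix j = nat ((j - 1) mod int n) + 1"

lemma ix_in: "ix j \<in> {1..n}"
proof -
  have "(j - 1) mod int n < int n" "0 \<le> (j - 1) mod int n"
    using n_ge_2 by auto
  then show ?thesis
    by (auto simp: ix_def)
qed

lemma ix_int: "i \<in> {1..n} \<Longrightarrow> ix (int i) = i"
  by (auto simp: ix_def nat_diff_distrib)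

lemma ix_eq_iff: "ix i = ix j \<longleftrightarrow> i mod int n = j mod int n"
proof -
  have "ix i = ix j \<longleftrightarrow> (i - 1) mod int n = (j - 1) mod int n"
    using n_ge_2 by (simp add: ix_def nat_eq_iff)
  also have "\<dots> \<longleftrightarrow> i mod int n = j mod int n"
    by (simp add: mod_eq_dvd_iff)
  finally show ?thesis .
qed

lemma ix_add [simp]: "ix (j + int n) = ix j"
  by (simp add: ix_eq_iff)

lemma ix_add_cong: "ix i = ix j \<Longrightarrow> ix (i + k) = ix (j + k)"
  unfolding ix_eq_iff by (rule mod_add_cong) simp_all

lemma ix_neq:
  assumes "i < j" "j < i + int n"
  shows "ix i \<noteq> ix j"
proof
  assume "ix i = ix j"
  then have "int n dvd j - i"
    by (simp add: ix_eq_iff mod_eq_dvd_iff dvd_diff_commute)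
  then show False
    using assms zdvd_imp_le[of "int n" "j - i"] by simp
qed

lemma int_ix: "\<exists>m. int (ix j) = j + m * int n"
proof -
  have "int (ix j) mod int n = j mod int n"
    using ix_eq_iff[of "int (ix j)" j] ix_int[OF ix_in] by simp
  then have "int n dvd int (ix j) - j"
    by (simp add: mod_eq_dvd_iff)
  then obtain m where "int (ix j) - j = int n * m"
    by blast
  then show ?thesis
    by (intro exI[of _ m]) (simp add: algebra_simps)
qed

lemma nxt_ix: "nxt n (ix j) = ix (j + 1)"
proof (cases "ix j = n")
  case True
  then have "ix j = ix 0"
    using ix_int[of n] ix_add[of 0] n_ge_2 by simp
  then have "ix (j + 1) = ix 1"
    using ix_add_cong[of j 0 1] by simp
  then show ?thesis
    using ix_int[of 1] n_ge_2 True by (simp add: nxt_def)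
next
  case False
  then have "ix (int (ix j + 1)) = ix j + 1"
    using ix_in[of j] by (intro ix_int) auto
  moreover have "ix (int (ix j + 1)) = ix (j + 1)"
    using ix_add_cong[of "int (ix j)" j 1] ix_int[OF ix_in] by (simp add: add.commute)
  ultimately show ?thesis
    using False by (simp add: nxt_def)
qed

text \<open>The two equations fix the action of an entry on the basis formed by the ends of its
  side: it is a transvection along the sum of these ends. Passing from j to j + n only changes
  signs, so the condition depends on j modulo n.\<close>

definition polygon_of :: "(int \<Rightarrow> complex) \<Rightarrow> (nat \<Rightarrow> freegrp) \<Rightarrow> bool" where
  "polygon_of H y \<longleftrightarrow> polygon H \<and>
     (\<forall>j. act (y (ix j)) (H (j + 1)) = - H j \<and> act (y (ix j)) (H j + H (j + 1)) = H j + H (j + 1))"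

lemma polygon_of_X: "polygon_of H0 X"
proof -
  have "act (X (ix j)) v = v - (dt (cusp j) v / sin (pi / n)) *\<^sub>R cusp j" for j v
  proof -
    obtain m where m: "int (ix j) = j + m * int n"
      using int_ix by blast
    have "cusp (int (ix j)) = H0 (j + m * int n) + H0 ((j + 1) + m * int n)"
      by (simp add: cusp_def m ac_simps)
    then have "cusp (int (ix j)) = (if even m then cusp j else - cusp j)"
      unfolding polygon_shift[OF polygon_H0] by (simp add: cusp_def)
    then show ?thesis
      by (simp add: act_X act_letter_def)
  qed
  moreover have "dt (H0 j) (H0 (j + 1)) = sin (pi / n)" for j
    by (simp add: dt_H0)
  moreover from this have "dt (H0 (j + 1)) (H0 j) = - sin (pi / n)" for j
    by (metis dt_swap)
  moreover have "0 < sin (pi / n)"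
    using polygon_pos[OF polygon_H0, of 0 1] n_ge_2 by (simp add: dt_H0)
  ultimately show ?thesis
    using polygon_H0 by (simp add: polygon_of_def) (simp add: cusp_def)
qed

text \<open>A vertex that moves within the cone over an adjacent side, short of its far edge,
  overtakes no other vertex: the old vertex contributes a positive area and the neighbour a
  nonnegative one. The sign \<open>e\<close> selects the side.\<close>

lemma polygon_update:
  assumes H: "polygon H" and e: "e = 1 \<or> e = - 1"
    and period: "\<And>j. H' (j + int n) = - H' j"
    and p: "\<And>j. ix j = p \<Longrightarrow> \<exists>r s. 0 < r \<and> 0 \<le> s \<and> H' j = r *\<^sub>R H j + s *\<^sub>R H (j + e)"
    and not_p: "\<And>j. ix j \<noteq> p \<Longrightarrow> H' j = H j"
  shows "polygon H'"
proof -
  have "0 < dt (H' a) (H' b)" if ab: "a < b" "b < a + int n" for a b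
  proof -
    note pos = polygon_pos[OF H ab]
    have nonneg: "0 \<le> dt (H (a + e)) (H b)" "0 \<le> dt (H a) (H (b + e))"
      using ab e by (intro polygon_nonneg[OF H]; linarith)+
    consider "ix a = p" "ix b \<noteq> p" | "ix a \<noteq> p" "ix b = p" | "ix a \<noteq> p" "ix b \<noteq> p"
      using ix_neq[OF ab] by auto
    then show ?thesis
    proof cases
      case 1
      then show ?thesis
        using p[of a] not_p[of b] pos nonneg by (auto intro!: add_pos_nonneg)
    next
      case 2
      then show ?thesis
        using p[of b] not_p[of a] pos nonneg by (auto intro!: add_pos_nonneg)
    next
      case 3
      then show ?thesis
        using not_p[of a] not_p[of b] pos by simp
    qed
  qed
  then show ?thesis
    using period by (simp add: polygon_def)
qed

text \<open>In the basis u, v the map sends u to 2u + v and v to -u. It is unipotent, (g - 1)^2 = 0,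
  which is the first claim; the other two are its matrix and the inverse matrix in the coordinates
  of Cramer's rule.\<close>

lemma parabolic:
  assumes "act g v = - u" "act g (u + v) = u + v" "dt u v \<noteq> 0"
  shows "act g (w - act g w) = w - act g w"
    and "act g w = (2 * dt w v / dt u v - dt u w / dt u v) *\<^sub>R u + (dt w v / dt u v) *\<^sub>R v"
    and "act (- g) w = (dt u w / dt u v) *\<^sub>R u + (2 * dt u w / dt u v - dt w v / dt u v) *\<^sub>R v"
proof -
  define \<alpha> \<beta> where "\<alpha> = dt w v / dt u v" and "\<beta> = dt u w / dt u v"
  have w: "w = \<alpha> *\<^sub>R u + \<beta> *\<^sub>R v"
    unfolding \<alpha>_def \<beta>_def using dt_basis[OF assms(3)] .
  have u: "act g u = 2 *\<^sub>R u + v"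
    using assms(1,2) by (simp add: scaleR_2 algebra_simps)
  have gw: "act g w = (2 * \<alpha> - \<beta>) *\<^sub>R u + \<alpha> *\<^sub>R v"
    by (subst w) (simp add: u assms(1) complex_eq_iff algebra_simps)
  show "act g w = (2 * dt w v / dt u v - dt u w / dt u v) *\<^sub>R u + (dt w v / dt u v) *\<^sub>R v"
    using gw by (simp add: \<alpha>_def \<beta>_def)
  have "w - act g w = (\<beta> - \<alpha>) *\<^sub>R (u + v)"
    unfolding gw by (subst w) (simp add: complex_eq_iff algebra_simps)
  then show "act g (w - act g w) = w - act g w"
    using assms(2) by (simp del: act_simps(1,3))
  have "act g (\<beta> *\<^sub>R u + (2 * \<beta> - \<alpha>) *\<^sub>R v) = w"
    by (subst w) (simp add: u assms(1) complex_eq_iff algebra_simps)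
  then have "act (- g) w = \<beta> *\<^sub>R u + (2 * \<beta> - \<alpha>) *\<^sub>R v"
    by (metis act_uminus_cancel(1))
  then show "act (- g) w = (dt u w / dt u v) *\<^sub>R u + (2 * dt u w / dt u v - dt w v / dt u v) *\<^sub>R v"
    by (simp add: \<alpha>_def \<beta>_def)
qed

text \<open>The only vertex that changes, up to sign, is the one shared by the two sides of the
  moved entries; both outer ends stay in place.\<close>

lemma polygon_of_move:
  assumes n3: "3 \<le> n" and y: "polygon_of H y" and i: "i \<in> {1..n}"
  shows "\<exists>H'. polygon_of H' (move (b, i) y)"
proof -
  define p where "p = nxt n i"
  have p: "p \<in> {1..n}" "p \<noteq> i"
    using i nxt_in nxt_neq by (auto simp: p_def)
  have H: "polygon H"
    and T1: "act (y (ix j)) (H (j + 1)) = - H j"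
    and T2: "act (y (ix j)) (H j + H (j + 1)) = H j + H (j + 1)" for j
    using y unfolding polygon_of_def by blast+
  have ix_p: "ix (j + 1) = p \<longleftrightarrow> ix j = i" for j
    using nxt_inj[OF ix_in i, of j] by (simp add: nxt_ix p_def)
  have ix_p': "ix j = p \<longleftrightarrow> ix (j - 1) = i" for j
    using ix_p[of "j - 1"] by simp
  have d1: "0 < dt (H j) (H (j + 1))" for j
    using polygon_pos[OF H] n_ge_2 by simp
  have d2: "0 < dt (H j) (H (j + 2))" for j
    using polygon_pos[OF H] n3 by simp
  have anti: "H (j + int n + k) = - H (j + k)" for j k
    using H unfolding polygon_def by (metis add.assoc add.commute)
  show ?thesis
  proof (cases b)
    case True
    \<comment> \<open>The new entry at p is \<open>y i\<close>, which must send
      \<open>H (j + 1)\<close> to the negative of the new vertex; this forces its position.\<close>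
    define H' where "H' j = (if ix j = p then - act (y i) (H (j + 1)) else H j)" for j
    have move: "move (b, i) y = y(i := conj_by True (y i) (y p), p := y i)"
      using True by (simp add: p_def)
    have par: "act (y i) (H j) = - H (j - 1)" "act (y i) (H (j - 1) + H j) = H (j - 1) + H j"
        "dt (H (j - 1)) (H j) \<noteq> 0" if "ix j = p" for j
      using T1[of "j - 1"] T2[of "j - 1"] d1[of "j - 1"] that by (simp_all add: ix_p')
    have "polygon H'"
    proof (rule polygon_update[OF H, of "- 1" H' p])
      show "H' (j + int n) = - H' j" for j
        using anti[of j 0] anti[of j 1] by (simp add: H'_def)
      fix j
      assume jp: "ix j = p"
      define r s where "r = dt (H j) (H (j + 1)) / dt (H (j - 1)) (H j)"
        and "s = 2 * r + dt (H (j - 1)) (H (j + 1)) / dt (H (j - 1)) (H j)"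
      have "H' j = r *\<^sub>R H j + s *\<^sub>R H (j - 1)"
        unfolding r_def s_def using parabolic(2)[OF par[OF jp], of "H (j + 1)"] dt_swap[of "H (j + 1)" "H j"] jp
        by (simp add: H'_def complex_eq_iff algebra_simps)
      moreover have "0 < r"
        using d1[of j] d1[of "j - 1"] by (simp add: r_def)
      moreover from this have "0 \<le> s"
        using d1[of "j - 1"] d2[of "j - 1"] by (simp add: s_def add.commute)
      ultimately show "\<exists>r s. 0 < r \<and> 0 \<le> s \<and> H' j = r *\<^sub>R H j + s *\<^sub>R H (j + - 1)"
        by auto
    qed (simp_all add: H'_def)
    moreover have "act (move (b, i) y (ix j)) (H' (j + 1)) = - H' j \<and>
        act (move (b, i) y (ix j)) (H' j + H' (j + 1)) = H' j + H' (j + 1)" for j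
    proof -
      consider "ix j = i" | "ix j = p" | "ix j \<noteq> i" "ix j \<noteq> p"
        by blast
      then show ?thesis
      proof cases
        case 1
        then have *: "ix (j + 1) = p" "ix j \<noteq> p"
          using p by (simp_all add: ix_p)
        define u v w where "u = H j" and "v = H (j + 1)" and "w = H (j + 1 + 1)"
        have "act (y p) w = - v" "act (y p) v + act (y p) w = v + w" "act (y i) v = - u"
          using T1[of "j + 1"] T2[of "j + 1"] T1[of j] 1 * by (simp_all add: u_def v_def w_def)
        moreover have "H' (j + 1) = - act (y i) w" "H' j = u"
          using * by (simp_all add: H'_def u_def w_def)
        moreover have "act (y p) v = v + w + v"
          using calculation by (simp add: algebra_simps)
        moreover have "move (b, i) y (ix j) = y i + (y p + - y i)"
          using 1 p by (simp add: move conj_by_def add.assoc diff_conv_add_uminus del: add_uminus_conv_diff)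
        moreover have "act (- y i) u = - v"
          using \<open>act (y i) v = - u\<close> by (metis act_simps(2) act_uminus_cancel(1) minus_minus)
        ultimately show ?thesis
          by (simp add: act_add del: add_uminus_conv_diff)
      next
        case 2
        then have *: "ix (j + 1) \<noteq> p"
          using p by (simp add: ix_p)
        show ?thesis
          using 2 * p par[OF 2] parabolic(1)[OF par[OF 2], of "H (j + 1)"]
          unfolding move H'_def by (simp add: algebra_simps)
      next
        case 3
        then have "ix (j + 1) \<noteq> p"
          by (simp add: ix_p)
        then show ?thesis
          using 3 T1[of j] T2[of j] unfolding move H'_def by simp
      qed
    qed
    ultimately show ?thesis
      unfolding polygon_of_def by blast
  next
    case False
    \<comment> \<open>The new entry at i is \<open>y p\<close>, which must send the new vertex to
      \<open>- H (j - 1)\<close>.\<close>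
    define H' where "H' j = (if ix j = p then - act (- y p) (H (j - 1)) else H j)" for j
    have move: "move (b, i) y = y(i := y p, p := conj_by False (y p) (y i))"
      using False by (simp add: p_def)
    have par: "act (y p) (H (j + 1)) = - H j" "act (y p) (H j + H (j + 1)) = H j + H (j + 1)"
        "dt (H j) (H (j + 1)) \<noteq> 0" if "ix j = p" for j
      using T1[of j] T2[of j] d1[of j] that by simp_all
    have "polygon H'"
    proof (rule polygon_update[OF H, of 1 H' p])
      show "H' (j + int n) = - H' j" for j
        using anti[of j 0] anti[of j "- 1"] by (simp add: H'_def)
      fix j
      assume jp: "ix j = p"
      define r s where "r = dt (H (j - 1)) (H j) / dt (H j) (H (j + 1))"
        and "s = 2 * r + dt (H (j - 1)) (H (j + 1)) / dt (H j) (H (j + 1))"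
      have "H' j = r *\<^sub>R H j + s *\<^sub>R H (j + 1)"
        unfolding r_def s_def using parabolic(3)[OF par[OF jp], of "H (j - 1)"] dt_swap[of "H j" "H (j - 1)"] jp
        by (simp add: H'_def complex_eq_iff algebra_simps)
      moreover have "0 < r"
        using d1[of j] d1[of "j - 1"] by (simp add: r_def)
      moreover from this have "0 \<le> s"
        using d1[of j] d2[of "j - 1"] by (simp add: s_def add.commute)
      ultimately show "\<exists>r s. 0 < r \<and> 0 \<le> s \<and> H' j = r *\<^sub>R H j + s *\<^sub>R H (j + 1)"
        by auto
    qed (simp_all add: H'_def)
    moreover have "act (move (b, i) y (ix j)) (H' (j + 1)) = - H' j \<and>
        act (move (b, i) y (ix j)) (H' j + H' (j + 1)) = H' j + H' (j + 1)" for j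
    proof -
      consider "ix j = i" | "ix j = p" | "ix j \<noteq> i" "ix j \<noteq> p"
        by blast
      then show ?thesis
      proof cases
        case 1
        then have *: "ix (j + 1) = p" "ix j \<noteq> p"
          using p by (simp_all add: ix_p)
        show ?thesis
          using 1 * p parabolic(1)[OF par[OF *(1)], of "act (- y p) (H j)"]
          unfolding move H'_def by (simp add: algebra_simps)
      next
        case 2
        then have *: "ix (j + 1) \<noteq> p" "ix (j - 1) = i"
          using p ix_p[of j] ix_p'[of j] by auto
        have "act (y i) (H j) = - H (j - 1)" "act (y i) (H (j - 1)) = H (j - 1) + H j + H (j - 1)"
            "act (y p) (H (j + 1)) = - H j"
          using T1[of "j - 1"] T2[of "j - 1"] * par[OF 2] by (simp_all add: algebra_simps)
        moreover from this have "act (- y p) (H j) = - H (j + 1)"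
          by (metis act_simps(2) act_uminus_cancel(1) minus_minus)
        ultimately show ?thesis
          using 2 * p unfolding move H'_def conj_by_def
          by (simp add: act_add algebra_simps)
      next
        case 3
        then have "ix (j + 1) \<noteq> p"
          by (simp add: ix_p)
        then show ?thesis
          using 3 T1[of j] T2[of j] unfolding move H'_def by simp
      qed
    qed
    ultimately show ?thesis
      unfolding polygon_of_def by blast
  qed
qed

section \<open>Ping-pong on the projective line\<close>

text \<open>Up to sign, the cone spanned by \<open>H0 k\<close> and \<open>H0 (k + 1)\<close> is cut by \<open>cusp k\<close> into an
  attracting cone of \<open>x\<^sub>k\<close> and one of its inverse. A vector satisfies \<open>region a\<close> if it lies in
  the open cone of the letter \<open>a\<close>, and \<open>outside a\<close> if it does not lie in the closed one.\<close>

fun region :: "letter \<Rightarrow> complex \<Rightarrow> bool" where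
  "region (True, k) v \<longleftrightarrow> 0 < dt (H0 (int k)) v * dt v (cusp (int k))"
| "region (False, k) v \<longleftrightarrow> 0 < dt v (H0 (int k + 1)) * dt (cusp (int k)) v"

fun outside :: "letter \<Rightarrow> complex \<Rightarrow> bool" where
  "outside (True, k) v \<longleftrightarrow> 0 < dt (H0 (int k)) v * dt (cusp (int k)) v"
| "outside (False, k) v \<longleftrightarrow> 0 < dt v (H0 (int k + 1)) * dt v (cusp (int k))"

definition side :: real where
  "side = sin (pi / n)"

lemma side_pos: "0 < side"
  using polygon_pos[OF polygon_H0, of 0 1] n_ge_2 by (simp add: dt_H0 side_def)

lemma dt_side: "dt (H0 j) (H0 (j + 1)) = side" "dt (H0 (j + 1)) (H0 j) = - side"
  by (simp_all add: dt_H0 side_def diff_divide_distrib right_diff_distrib)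

lemma act_letter_alt:
  "act_letter (b, k) v = v + ((if b then - 1 else 1) * dt (cusp (int k)) v / side) *\<^sub>R cusp (int k)"
  by (simp add: act_letter_def side_def)

text \<open>The transvection fixes the cusp line and carries one outer edge of the arc to the other,
  so it maps everything off one half of the arc into the other half. Products of two areas make the
  conditions insensitive to the sign of v.\<close>

lemma region_act_letter:
  assumes "outside (inv_letter a) v"
  shows "region a (act_letter a v)"
proof -
  obtain b k where a: "a = (b, k)"
    by (cases a)
  define A B C where "A = H0 (int k)" and "B = H0 (int k + 1)" and "C = cusp (int k)"
  have AB: "dt A C = side" "dt C B = side" "dt C v = dt A v - dt v B"
    by (simp_all add: A_def B_def C_def dt_side cusp_def dt_swap[of v])
  have "dt A (act_letter (True, k) v) = dt v B" "dt (act_letter (True, k) v) C = dt v C"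
      "dt (act_letter (False, k) v) B = dt A v" "dt C (act_letter (False, k) v) = dt C v"
    using side_pos by (simp_all add: act_letter_alt AB flip: C_def)
  then show ?thesis
    using assms unfolding a A_def B_def C_def by (cases b) simp_all
qed

text \<open>A vector over arc j has both ends of another arc on the same side of its line, hence
  also the cusp, which is the sum of these ends.\<close>

lemma outside_other_cone:
  assumes "0 < dt (H0 (int j)) v * dt v (H0 (int j + 1))" "j \<noteq> k" "j \<in> {1..n}" "k \<in> {1..n}"
  shows "outside (b, k) v"
proof -
  \<comment> \<open>The representative of k modulo n directly above j puts both ends of the arc
    within a half-turn after \<open>H0 j\<close>. The possible shift by n flips both ends and
    disappears in the product.\<close>
  define K where "K = (if j < k then int k else int k + int n)"
  have K: "int j < K" "K < int j + int n"
    using assms by (auto simp: K_def)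
  define A B P Q where "A = H0 (int j)" and "B = H0 (int j + 1)" and "P = H0 K" and "Q = H0 (K + 1)"
  define a b' where "a = dt v B" and "b' = dt A v"
  have ab: "0 < a * b'"
    using assms(1) by (simp add: a_def b'_def A_def B_def mult.commute)
  have AB: "dt A B = side"
    by (simp add: A_def B_def dt_side)
  \<comment> \<open>The Pluecker relation: the expansion of v in \<open>A\<close> and
    \<open>B\<close> with the denominator cleared.\<close>
  have pl: "dt A B * dt v w = a * dt A w + b' * dt B w" for w
    by (simp add: a_def b'_def dt_def algebra_simps)
  have *: "0 < dt A P" "0 \<le> dt A Q" "0 \<le> dt B P" "0 < dt B Q"
    using K polygon_pos[OF polygon_H0] polygon_nonneg[OF polygon_H0]
    by (simp_all add: A_def B_def P_def Q_def)
  have "(side * dt v P) * (side * dt v Q)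
      = a\<^sup>2 * (dt A P * dt A Q) + b'\<^sup>2 * (dt B P * dt B Q) + a * b' * (dt B P * dt A Q) + a * b' * (dt A P * dt B Q)"
    unfolding AB[symmetric] pl by (simp add: algebra_simps power2_eq_square)
  moreover have "0 \<le> a\<^sup>2 * (dt A P * dt A Q)" "0 \<le> b'\<^sup>2 * (dt B P * dt B Q)"
    using * by simp_all
  moreover have "0 \<le> a * b' * (dt B P * dt A Q)"
    by (rule mult_nonneg_nonneg[OF less_imp_le[OF ab] mult_nonneg_nonneg[OF *(3) *(2)]])
  moreover have "0 < a * b' * (dt A P * dt B Q)"
    by (rule mult_pos_pos[OF ab mult_pos_pos[OF *(1) *(4)]])
  ultimately have "0 < (side * dt v P) * (side * dt v Q)"
    by linarith
  then have "0 < (side * side) * (dt v P * dt v Q)"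
    by (simp only: mult_ac)
  then have PQ: "0 < dt v P * dt v Q"
    using side_pos by (simp add: zero_less_mult_iff)
  moreover have "(dt v (H0 (int k)) = dt v P \<and> dt v (H0 (int k + 1)) = dt v Q) \<or>
      (dt v (H0 (int k)) = - dt v P \<and> dt v (H0 (int k + 1)) = - dt v Q)"
    using polygon_shift[OF polygon_H0, of "int k" 1] polygon_shift[OF polygon_H0, of "int k + 1" 1]
    by (auto simp: P_def Q_def K_def ac_simps)
  ultimately have pos: "0 < dt v (H0 (int k)) * dt v (H0 (int k + 1))"
    by auto
  define x z where "x = dt v (H0 (int k))" and "z = dt v (H0 (int k + 1))"
  have "0 < x * z"
    using pos by (simp add: x_def z_def)
  then have "0 < x * (x + z)" "0 < z * (x + z)"
    by (simp_all add: distrib_left add_nonneg_pos add_pos_nonneg mult.commute)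
  moreover have "dt (H0 (int k)) v = - x" "dt (cusp (int k)) v = - (x + z)"
      "dt v (cusp (int k)) = x + z" "dt v (H0 (int k + 1)) = z"
    by (simp_all add: cusp_def x_def z_def dt_swap[of "H0 _" v])
  ultimately show ?thesis
    by (cases b) (simp_all del: minus_add_distrib)
qed

text \<open>The two halves of one arc meet only along the cusp line, which the open region avoids;
  different arcs are the case of \<open>outside_other_cone\<close>.\<close>

lemma outside_region:
  assumes "region b v" "b \<noteq> a" "snd a \<in> {1..n}" "snd b \<in> {1..n}"
  shows "outside a v"
proof -
  obtain d j where b: "b = (d, j)"
    by (cases b)
  obtain e' k where a: "a = (e', k)"
    by (cases a)
  define x z where "x = dt (H0 (int j)) v" and "z = dt v (H0 (int j + 1))"
  have sw: "dt v (H0 (int j)) = - x" "dt (H0 (int j + 1)) v = - z"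
    unfolding x_def z_def by (rule dt_swap)+
  have e: "dt v (cusp (int j)) = z - x" "dt (cusp (int j)) v = x - z"
      "dt (H0 (int j)) v = x" "dt v (H0 (int j + 1)) = z"
    using sw by (simp_all add: cusp_def x_def z_def)
  have reg: "if d then 0 < x * (z - x) else 0 < z * (x - z)"
    using assms(1) unfolding b by (cases d) (simp_all add: e)
  show ?thesis
  proof (cases "j = k")
    case True
    then have "e' = (\<not> d)"
      using assms(2) by (auto simp: a b)
    moreover have "z * (z - x) = x * (z - x) + (z - x)\<^sup>2" "x * (x - z) = z * (x - z) + (x - z)\<^sup>2"
      by (simp_all add: algebra_simps power2_eq_square)
    then have "if d then 0 < z * (z - x) else 0 < x * (x - z)"
      using reg by (auto intro: add_pos_nonneg)
    ultimately show ?thesis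
      unfolding a True[symmetric] by (cases d) (simp_all add: e)
  next
    case False
    have "x * z = x * (z - x) + x\<^sup>2" "x * z = z * (x - z) + z\<^sup>2"
      by (simp_all add: algebra_simps power2_eq_square)
    then have "0 < x * z"
      using reg by (metis add_pos_nonneg zero_le_power2)
    then show ?thesis
      using outside_other_cone[of j v k e'] False assms(3,4) by (simp add: a b x_def z_def)
  qed
qed

text \<open>Ping-pong started at a cusp. The cusp of c lies on the common edge of the two regions of
  c, so the first letter applied must have another index, and this is what \<open>good\<close>
  provides.\<close>

lemma region_elt_cusp:
  assumes "t \<noteq> []" "snd ` set t \<subseteq> {1..n}" "good c t" "c \<in> {1..n}"
  shows "region (hd t) (act (elt t) (cusp (int c)))"
  using assms
proof (induction t)
  case (Cons a t)
  have "outside (inv_letter a) (act (elt t) (cusp (int c)))"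
  proof (cases "t = []")
    case True
    then have "snd a \<noteq> c"
      using Cons.prems by (auto simp: good_def)
    moreover have "0 < dt (H0 (int c)) (cusp (int c)) * dt (cusp (int c)) (H0 (int c + 1))"
      using side_pos by (simp add: cusp_def dt_side)
    ultimately show ?thesis
      using outside_other_cone[of c "cusp (int c)" "snd a" "\<not> fst a"] Cons.prems True
      by (cases a) auto
  next
    case False
    then have "good c t"
      using Cons.prems by (auto simp: good_def reduced_Cons)
    then have "region (hd t) (act (elt t) (cusp (int c)))"
      using Cons False by auto
    moreover have "hd t \<noteq> inv_letter a" "hd t \<in> set t"
      using Cons.prems False by (auto simp: good_def reduced_Cons)
    ultimately show ?thesis
      using Cons.prems by (intro outside_region) auto
  qed
  then show ?case
    using region_act_letter by (simp add: act_elt)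
qed simp

text \<open>The fixed line of w x_c w^-1 is the image under w of the cusp line of c. This links the
  sides of the polygon, known through their fixed vectors, with the words.\<close>

lemma fixed_vector_conj_gen:
  assumes "act (conj_gen w c) f = f" "f \<noteq> 0"
  obtains r where "r \<noteq> 0" "act (- elt w) f = r *\<^sub>R cusp (int c)"
proof -
  define g where "g = act (- elt w) f"
  have "act (conj_gen w c) f = act (elt w) (act (X c) g)"
    unfolding conj_gen_def g_def diff_conv_add_uminus act_add ..
  then have "act (elt w) (act (X c) g) = f"
    using assms(1) by simp
  then have "act (X c) g = g"
    unfolding g_def by (metis act_uminus_cancel(1))
  moreover have cusp: "dt (cusp (int c)) (H0 (int c + 1)) = side"
    by (simp add: cusp_def dt_side)
  then have "cusp (int c) \<noteq> 0"
    using side_pos by (auto simp: dt_def)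
  ultimately have "dt (cusp (int c)) g = 0"
    using side_pos by (simp add: act_X act_letter_alt)
  then have "g = (dt g (H0 (int c + 1)) / side) *\<^sub>R cusp (int c)"
    using dt_basis[of "cusp (int c)" "H0 (int c + 1)" g] cusp side_pos by simp
  moreover have "f = act (elt w) g"
    by (simp add: g_def)
  then have "g \<noteq> 0"
    using assms(2) act_simps(4)[of "elt w" 0 0] by auto
  ultimately show ?thesis
    using that[of "dt g (H0 (int c + 1)) / side"] by (metis g_def scaleR_zero_left)
qed

section \<open>Exclusion of two opposite descents\<close>

lemma region_scaleR: "r \<noteq> 0 \<Longrightarrow> region a v \<Longrightarrow> region a (r *\<^sub>R v)"
  by (cases "(a, v)" rule: region.cases)
    (auto simp: mult_ac zero_less_mult_iff mult_less_0_iff linorder_neq_iff)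

text \<open>The real inequalities behind \<open>no_opposite_descents\<close>: (a, b) is the end of
  the middle side, (\<alpha>, \<beta>) and (\<gamma>, \<delta>) are the fixed vectors of its
  neighbours. All of \<alpha> - \<beta>, \<beta>, \<delta> - \<gamma>, \<gamma> inherit the sign of
  b - a, and then the left neighbour and the right one demand opposite signs of a.\<close>

lemma sign_clash:
  fixes a b \<alpha> \<beta> \<gamma> \<delta> :: real
  assumes "0 < - a * (\<alpha> - \<beta>) - \<beta> * (b - a)" "0 < (b - a) * (\<alpha> - \<beta>)" "0 < \<beta> * (\<alpha> - \<beta>)"
    and "0 < (b - a) * (\<delta> - \<gamma>)" "0 < a * (\<delta> - \<gamma>) - \<gamma> * (b - a)" "0 < \<gamma> * (\<delta> - \<gamma>)"
  shows False
proof (cases "0 < \<alpha> - \<beta>")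
  case True
  then have 1: "0 < \<beta>" "0 < b - a"
    using assms by (auto simp: zero_less_mult_iff)
  then have 2: "0 < \<delta> - \<gamma>" "0 < \<gamma>"
    using assms by (auto simp: zero_less_mult_iff)
  have "0 < - a * (\<alpha> - \<beta>)" "0 < a * (\<delta> - \<gamma>)"
    using assms(1,5) mult_pos_pos[OF 1] mult_pos_pos[OF 2(2) 1(2)] by linarith+
  then show False
    using True 2 by (auto simp: zero_less_mult_iff mult_less_0_iff)
next
  case False
  then have 0: "\<alpha> - \<beta> < 0"
    using assms(2) by (cases "\<alpha> = \<beta>") auto
  then have 1: "\<beta> < 0" "b - a < 0"
    using assms by (auto simp: zero_less_mult_iff)
  then have 2: "\<delta> - \<gamma> < 0" "\<gamma> < 0"
    using assms by (auto simp: zero_less_mult_iff)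
  have "0 < - a * (\<alpha> - \<beta>)" "0 < a * (\<delta> - \<gamma>)"
    using assms(1,5) mult_neg_neg[OF 1] mult_neg_neg[OF 2(2) 1(2)] by linarith+
  then show False
    using 0 2 by (auto simp: zero_less_mult_iff mult_less_0_iff)
qed

lemma no_opposite_descents:
  assumes n3: "3 \<le> n" and H: "polygon_of H y" and d: "normal_data c w y" and i: "i \<in> {1..n}"
  defines "p \<equiv> nxt n i"
  defines "q \<equiv> nxt n p"
  assumes pre_i: "prefix (w p @ [(True, c p)]) (w i)" and pre_q: "prefix (w p @ [(False, c p)]) (w q)"
  shows False
proof -
  define j where "j = int i"
  have ix: "ix j = i" "ix (j + 1) = p" "ix (j + 2) = q"
    using i nxt_ix[of j] nxt_ix[of "j + 1"] by (simp_all add: j_def ix_int p_def q_def add.commute)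
  have "p \<in> {1..n}"
    using i nxt_in by (simp add: p_def)
  have poly: "polygon H"
    and T1: "act (y (ix k)) (H (k + 1)) = - H k"
    and T2: "act (y (ix k)) (H k + H (k + 1)) = H k + H (k + 1)" for k
    using H unfolding polygon_of_def by blast+
  have dat: "good (c k) (w k)" "snd ` set (w k) \<subseteq> {1..n}" "y k = conj_gen (w k) (c k)" "c k \<in> {1..n}"
    if "k \<in> {1..n}" for k
    using d that permutes_in_image[of c "{1..n}" k] by (auto simp: normal_data_def)
  \<comment> \<open>Translating by the inverse of \<open>w p\<close> turns the middle entry into the
    generator x_{c(p)}, and the prefix hypotheses into statements about first letters.\<close>
  define h where "h k = act (- elt (w p)) (H k)" for k
  have dt_h: "dt (h a) (h b) = dt (H a) (H b)" for a b
    by (simp add: h_def)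
  have pos: "0 < dt (h a) (h (a + 1))" "0 < dt (h a) (h (a + 2))" for a
    using polygon_pos[OF poly] n3 by (simp_all add: dt_h)
  \<comment> \<open>The fixed line of the entry at m passes through the sum of the ends of its side;
    ping-pong locates the translated line by the letter that follows \<open>w p\<close>.\<close>
  have region: "region l (h m + h (m + 1))" if pre: "prefix (w p @ [l]) (w (ix m))" for l m
  proof -
    obtain t where t: "w (ix m) = w p @ l # t"
      using pre by (auto elim: prefixE)
    define r where "r = ix m"
    define F where "F = H m + H (m + 1)"
    have "act (conj_gen (w r) (c r)) F = F"
      using T2[of m] dat(3)[OF ix_in[of m]] by (simp add: r_def F_def)
    moreover have "0 < dt (H m) F"
      using pos(1)[of m] by (simp add: F_def dt_h)
    then have "F \<noteq> 0"
      by (auto simp: dt_def)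
    ultimately obtain e where e: "e \<noteq> 0" "act (- elt (w r)) F = e *\<^sub>R cusp (int (c r))"
      by (rule fixed_vector_conj_gen)
    have "F = act (elt (w r)) (e *\<^sub>R cusp (int (c r)))"
      unfolding e(2)[symmetric] by simp
    also have "\<dots> = act (elt (w p)) (e *\<^sub>R act (elt (l # t)) (cusp (int (c r))))"
      using t by (simp add: r_def elt_append act_add)
    finally have "act (- elt (w p)) F = e *\<^sub>R act (elt (l # t)) (cusp (int (c r)))"
      by simp
    moreover have "good (c r) (l # t)" "snd ` set (l # t) \<subseteq> {1..n}"
      using dat(1,2)[OF ix_in[of m]] t by (auto simp: r_def good_def reduced_append)
    then have "region l (act (elt (l # t)) (cusp (int (c r))))"
      using region_elt_cusp[of "l # t" "c r"] dat(4)[OF ix_in[of m]] by (simp add: r_def)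
    ultimately show ?thesis
      using region_scaleR[OF e(1)] by (simp add: F_def h_def)
  qed
  define A B where "A = H0 (int (c p))" and "B = H0 (int (c p) + 1)"
  have AB: "dt A B = side" "dt B A = - side" "cusp (int (c p)) = A + B"
    by (simp_all add: A_def B_def dt_side cusp_def)
  have coord: "v = (dt v B / side) *\<^sub>R A + (dt A v / side) *\<^sub>R B" for v
    using dt_basis[of A B v] AB side_pos by simp
  define a b where "a = dt (h (j + 2)) B / side" and "b = dt A (h (j + 2)) / side"
  define \<alpha> \<beta> where "\<alpha> = dt (h j + h (j + 1)) B / side" and "\<beta> = dt A (h j + h (j + 1)) / side"
  define \<gamma> \<delta> where "\<gamma> = dt (h (j + 2) + h (j + 3)) B / side" and "\<delta> = dt A (h (j + 2) + h (j + 3)) / side"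
  have h3: "h (j + 2) = a *\<^sub>R A + b *\<^sub>R B"
    and F1: "h j + h (j + 1) = \<alpha> *\<^sub>R A + \<beta> *\<^sub>R B"
    and F3: "h (j + 2) + h (j + 3) = \<gamma> *\<^sub>R A + \<delta> *\<^sub>R B"
    unfolding a_def b_def \<alpha>_def \<beta>_def \<gamma>_def \<delta>_def by (rule coord)+
  have XAB: "act (X (c p)) B = - A" "act (X (c p)) (A + B) = A + B"
    using polygon_of_X ix_int[OF dat(4)[OF \<open>p \<in> {1..n}\<close>]] unfolding polygon_of_def A_def B_def
    by metis+
  \<comment> \<open>The start of the middle side is determined by its end, so a and b describe the
    whole side.\<close>
  have "act (X (c p)) (h (j + 2)) = - h (j + 1)"
  proof -
    have "act (elt (w p)) (act (X (c p)) (h (j + 2))) = act (y p) (H (j + 2))"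
      unfolding dat(3)[OF \<open>p \<in> {1..n}\<close>] conj_gen_def h_def diff_conv_add_uminus act_add ..
    also have "\<dots> = - H (j + 1)"
      using T1[of "j + 1"] ix by (simp add: add.commute)
    finally show ?thesis
      by (metis act_simps(2) act_uminus_cancel(1) h_def)
  qed
  then have "- h (j + 1) = (2 * a - b) *\<^sub>R A + a *\<^sub>R B"
    using parabolic(2)[OF XAB, of "h (j + 2)"] AB side_pos by (simp add: a_def b_def)
  then have "h (j + 1) = - ((2 * a - b) *\<^sub>R A + a *\<^sub>R B)"
    by (metis minus_minus)
  then have h2: "h (j + 1) = (b - 2 * a) *\<^sub>R A + (- a) *\<^sub>R B"
    by (simp add: complex_eq_iff algebra_simps)
  have h23: "h (j + 1) + h (j + 2) = (b - a) *\<^sub>R (A + B)"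
    unfolding h2 h3 by (simp add: complex_eq_iff algebra_simps)
  \<comment> \<open>Facts 1, 2, 4 and 5 express the angular order of the polygon, facts 3 and 6 the
    regions found by ping-pong.\<close>
  have "0 < dt (h j + h (j + 1)) (h (j + 1))"
    using pos(1)[of j] by simp
  also have "dt (h j + h (j + 1)) (h (j + 1)) = side * (- a * (\<alpha> - \<beta>) - \<beta> * (b - a))"
    unfolding F1 unfolding h2 by (simp add: AB algebra_simps)
  finally have 1: "0 < - a * (\<alpha> - \<beta>) - \<beta> * (b - a)"
    using side_pos by (rule zero_less_mult_pos)
  have "0 < dt (h j + h (j + 1)) (h (j + 1) + h (j + 2))"
    using pos(1)[of j] pos(2)[of j] pos(1)[of "j + 1"] by (simp add: add.commute)
  also have "dt (h j + h (j + 1)) (h (j + 1) + h (j + 2)) = side * ((b - a) * (\<alpha> - \<beta>))"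
    unfolding F1 unfolding h23 by (simp add: AB algebra_simps)
  finally have 2: "0 < (b - a) * (\<alpha> - \<beta>)"
    using side_pos by (rule zero_less_mult_pos)
  have "0 < dt A (h j + h (j + 1)) * dt (h j + h (j + 1)) (A + B)"
    using region[of "(True, c p)" j] pre_i ix by (simp only: region.simps AB A_def)
  also have "dt A (h j + h (j + 1)) * dt (h j + h (j + 1)) (A + B) = side * side * (\<beta> * (\<alpha> - \<beta>))"
    unfolding F1 by (simp add: AB algebra_simps)
  finally have 3: "0 < \<beta> * (\<alpha> - \<beta>)"
    using side_pos by (meson mult_pos_pos zero_less_mult_pos)
  have "0 < dt (h (j + 1) + h (j + 2)) (h (j + 2) + h (j + 3))"
    using pos(1)[of "j + 1"] pos(2)[of "j + 1"] pos(1)[of "j + 2"] by (simp add: add.commute)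
  also have "dt (h (j + 1) + h (j + 2)) (h (j + 2) + h (j + 3)) = side * ((b - a) * (\<delta> - \<gamma>))"
    unfolding F3 unfolding h23 by (simp add: AB algebra_simps)
  finally have 4: "0 < (b - a) * (\<delta> - \<gamma>)"
    using side_pos by (rule zero_less_mult_pos)
  have "0 < dt (h (j + 2)) (h (j + 2) + h (j + 3))"
    using pos(1)[of "j + 2"] by (simp add: add.commute)
  also have "dt (h (j + 2)) (h (j + 2) + h (j + 3)) = side * (a * (\<delta> - \<gamma>) - \<gamma> * (b - a))"
    unfolding F3 unfolding h3 by (simp add: AB algebra_simps)
  finally have 5: "0 < a * (\<delta> - \<gamma>) - \<gamma> * (b - a)"
    using side_pos by (rule zero_less_mult_pos)
  have "0 < dt (h (j + 2) + h (j + 3)) B * dt (A + B) (h (j + 2) + h (j + 3))"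
    using region[of "(False, c p)" "j + 2"] pre_q ix by (simp add: AB B_def add.commute)
  also have "dt (h (j + 2) + h (j + 3)) B * dt (A + B) (h (j + 2) + h (j + 3)) = side * side * (\<gamma> * (\<delta> - \<gamma>))"
    unfolding F3 by (simp add: AB algebra_simps)
  finally have 6: "0 < \<gamma> * (\<delta> - \<gamma>)"
    using side_pos by (meson mult_pos_pos zero_less_mult_pos)
  show False
    by (rule sign_clash[OF 1 2 3 4 5 6])
qed

end

section \<open>Joining descents\<close>

text \<open>Cancelling against the nearer word leaves the nested prefix exposed, so the second
  conjugation shortens again. This bounds the bottom of the hexagon of a braid relation.\<close>

lemma conj_by_shorter2:
  assumes "good c3 w3" "prefix (w1 @ [(\<not> b, c1)]) w2" "prefix (w2 @ [(\<not> d, c2)]) w3"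
  shows "glen (conj_by b (conj_gen w1 c1) (conj_by d (conj_gen w2 c2) (conj_gen w3 c3))) < glen (conj_gen w3 c3)"
proof -
  from assms(2) obtain s where s: "w2 = w1 @ [(\<not> b, c1)] @ s"
    by (auto elim: prefixE)
  from assms(3) obtain t where t: "w3 = w2 @ [(\<not> d, c2)] @ t"
    by (auto elim: prefixE)
  have "conj_by d (conj_gen w2 c2) (conj_gen w3 c3) = conj_gen (w1 @ [(\<not> b, c1)] @ (s @ t)) c3"
    unfolding t conj_by_conj_gen_prefix by (simp add: s)
  then have "conj_by b (conj_gen w1 c1) (conj_by d (conj_gen w2 c2) (conj_gen w3 c3)) = conj_gen (w1 @ s @ t) c3"
    by (simp only: conj_by_conj_gen_prefix)
  moreover have "length w3 = length (w1 @ s @ t) + 2"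
    unfolding t s by simp
  ultimately show ?thesis
    using glen_conj_gen_le[of "w1 @ s @ t" c3] glen_conj_gen[OF assms(1)] by simp
qed

text \<open>Conjugation is an automorphism; this self-distributive law makes the two sides of every
  braid-shaped join end at the same tuple.\<close>

lemma conj_by_distrib:
  "conj_by b (conj_by d g h) (conj_by d g k) = conj_by d g (conj_by b h k)"
  unfolding conj_by_def by (cases b; cases d) (simp_all only: group_simps if_True if_False)

context annulus
begin

text \<open>The paths that close a peak are allowed to rise again as long as they stay under the
  peak; this is the weak form of confluence on which the Newman-style induction runs.\<close>

fun below :: "nat \<Rightarrow> word \<Rightarrow> (nat \<Rightarrow> freegrp) \<Rightarrow> bool" where
  "below m [] y \<longleftrightarrow> height y < m"
| "below m (a # p) y \<longleftrightarrow> height y < m \<and> below m p (move a y)"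

definition joinable :: "letter \<Rightarrow> letter \<Rightarrow> (nat \<Rightarrow> freegrp) \<Rightarrow> bool" where
  "joinable a b y \<longleftrightarrow> (\<exists>p\<in>sigma_words n. \<exists>q\<in>sigma_words n. braid_eq n (a # p) (b # q) \<and>
     fold move p (move a y) = fold move q (move b y) \<and>
     below (height y) p (move a y) \<and> below (height y) q (move b y))"

lemma joinableI:
  assumes "p \<in> sigma_words n" "q \<in> sigma_words n" "braid_eq n (a # p) (b # q)"
    "fold move p (move a y) = fold move q (move b y)"
    "below (height y) p (move a y)" "below (height y) q (move b y)"
  shows "joinable a b y"
  using assms unfolding joinable_def by blast

lemma joinable_sym: "joinable a b y \<Longrightarrow> joinable b a y"
  unfolding joinable_def by (metis braid_eq.sym)

lemma height_move_local:
  assumes "i \<in> {1..n}" "y' i = y i" "y' (nxt n i) = y (nxt n i)"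
  shows "height (move (b, i) y') + height y = height (move (b, i) y) + height y'"
proof -
  have *: "nxt n i \<in> {1..n}" "i \<noteq> nxt n i"
    using assms(1) nxt_in nxt_neq[of i] by auto
  have "height (y'(i := g, nxt n i := h)) + height y = height (y(i := g, nxt n i := h)) + height y'" for g h
    using height_upd2[OF assms(1) *, of y g h] height_upd2[OF assms(1) *, of y' g h] assms(2,3) by simp
  then show ?thesis
    using assms(2,3) by (cases b) simp_all
qed

lemma joinable_far:
  assumes i: "i \<in> {1..n}" and j: "j \<in> {1..n}" and far: "i \<noteq> j" "j \<noteq> nxt n i" "i \<noteq> nxt n j"
    and desc: "descends (b, i) y" "descends (d, j) y"
  shows "joinable (b, i) (d, j) y"
proof -
  have nij: "nxt n i \<noteq> nxt n j"
    using nxt_inj[OF i j] far by simp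
  have comm: "move (d, j) (move (b, i) y) = move (b, i) (move (d, j) y)"
    using far nij by (cases b; cases d) (auto simp: fun_eq_iff)
  have "move (d, j) y i = y i" "move (d, j) y (nxt n i) = y (nxt n i)"
    using far nij by (cases d; simp)+
  from height_move_local[of i "move (d, j) y" y b, OF i this]
  have "height (move (b, i) (move (d, j) y)) < height y"
    using desc by (simp add: descends_def)
  then show ?thesis
    using braid_eq_far_commute[OF i j far, of b d] comm desc i j
    by (intro joinableI[of "[(d, j)]" "[(b, i)]"]) (simp_all add: descends_def)
qed

lemma joinable_adjacent:
  assumes n3: "3 \<le> n" and i: "i \<in> {1..n}" and d: "normal_data c w y" and H: "polygon_of H y"
    and desc: "descends (b, i) y" "descends (b', nxt n i) y"
  shows "joinable (b, i) (b', nxt n i) y"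
proof -
  define j k where "j = nxt n i" and "k = nxt n j"
  have jk: "j \<in> {1..n}" "k \<in> {1..n}" "j \<noteq> i" "k \<noteq> j" "k \<noteq> i"
    using i nxt_in nxt_neq nxt_nxt_neq[OF n3] by (auto simp: j_def k_def)
  \<comment> \<open>Only three positions are involved. As explicit triples, the paths are evaluated
    by rewriting and their heights compared by three lengths.\<close>
  define tr where "tr a1 a2 a3 = y(i := a1, j := a2, k := a3)" for a1 a2 a3
  define y1 y2 y3 where "y1 = y i" and "y2 = y j" and "y3 = y k"
  have y: "y = tr y1 y2 y3"
    by (simp add: tr_def y1_def y2_def y3_def)
  have tr: "move (True, i) (tr a1 a2 a3) = tr (conj_by True a1 a2) a1 a3"
    "move (False, i) (tr a1 a2 a3) = tr a2 (conj_by False a2 a1) a3"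
    "move (True, j) (tr a1 a2 a3) = tr a1 (conj_by True a2 a3) a2"
    "move (False, j) (tr a1 a2 a3) = tr a1 a3 (conj_by False a3 a2)" for a1 a2 a3
    using jk by (auto simp: tr_def fun_eq_iff simp flip: j_def k_def)
  have height: "height (tr a1 a2 a3) < height y"
    if "glen a1 + glen a2 + glen a3 < glen y1 + glen y2 + glen y3" for a1 a2 a3
  proof -
    have "height (y(i := a1, j := a2)) + (glen y1 + glen y2) = height y + (glen a1 + glen a2)"
      using height_upd2[OF i jk(1)] jk by (simp add: y1_def y2_def)
    moreover have "height (y(i := a1, j := a2, k := a3)) + (glen a2 + glen y3) =
        height (y(i := a1, j := a2)) + (glen a2 + glen a3)"
      using height_upd2[OF jk(1) jk(2) not_sym[OF jk(4)], of "y(i := a1, j := a2)" a2 a3] jk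
      by (simp add: y3_def)
    ultimately show ?thesis
      using that by (simp add: tr_def)
  qed
  have dat: "good (c k) (w k)" "y k = conj_gen (w k) (c k)" if "k \<in> {1..n}" for k
    using d that by (auto simp: normal_data_def)
  note y123 = dat(2)[OF i, folded y1_def] dat(2)[OF jk(1), folded y2_def] dat(2)[OF jk(2), folded y3_def]
  note g123 = dat(1)[OF i] dat(1)[OF jk(1)] dat(1)[OF jk(2)]
  note sh = conj_by_shorter[where b = True, simplified] conj_by_shorter[where b = False, simplified]
  note sh2 = conj_by_shorter2[where b = True and d = True, simplified]
    conj_by_shorter2[where b = True and d = False, simplified]
    conj_by_shorter2[where b = False and d = True, simplified]
    conj_by_shorter2[where b = False and d = False, simplified]
  note cases_i = descends_cases(1,2)[OF d i, folded j_def]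
  note cases_j = descends_cases(1,2)[OF d jk(1), folded k_def]
  have desc_j: "descends (b', j) y"
    using desc(2) by (simp add: j_def)
  consider "b" "b'" | "\<not> b" "\<not> b'" | "b" "\<not> b'" | "\<not> b" "b'"
    by blast
  then have "joinable (b, i) (b', j) y"
  proof cases
    case 1
    have p: "prefix (w i @ [(False, c i)]) (w j)" "prefix (w j @ [(False, c j)]) (w k)"
      using 1 desc(1) desc_j cases_i cases_j by auto
    then have p': "prefix (w i @ [(False, c i)]) (w k)"
      by (meson append_prefixD prefix_order.trans)
    note l = sh(1)[OF g123(2) p(1), folded y123] sh(1)[OF g123(3) p(2), folded y123]
      sh(1)[OF g123(3) p', folded y123] sh2(1)[OF g123(3) p, folded y123]
    have e: "conj_by True (conj_by True y1 y2) (conj_by True y1 y3) = conj_by True y1 (conj_by True y2 y3)"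
      by (rule conj_by_distrib)
    show ?thesis
      using 1 i jk l braid_rel_pos[OF n3 i j_def] e
      by (intro joinableI[of "[(True, j), (True, i)]" "[(True, i), (True, j)]"])
        (simp_all add: arg_cong[OF y, of "move _"] tr height del: move.simps)
  next
    case 2
    have p: "prefix (w j @ [(True, c j)]) (w i)" "prefix (w k @ [(True, c k)]) (w j)"
      using 2 desc(1) desc_j cases_i cases_j by auto
    then have p': "prefix (w k @ [(True, c k)]) (w i)"
      by (meson append_prefixD prefix_order.trans)
    note l = sh(2)[OF g123(1) p(1), folded y123] sh(2)[OF g123(2) p(2), folded y123]
      sh(2)[OF g123(1) p', folded y123] sh2(4)[OF g123(1) p(2,1), folded y123]
    have e: "conj_by False (conj_by False y3 y2) (conj_by False y3 y1) = conj_by False y3 (conj_by False y2 y1)"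
      by (rule conj_by_distrib)
    show ?thesis
      using 2 i jk l braid_rel_neg[OF n3 i j_def] e
      by (intro joinableI[of "[(False, j), (False, i)]" "[(False, i), (False, j)]"])
        (simp_all add: arg_cong[OF y, of "move _"] tr height del: move.simps)
  next
    case 3
    have p: "prefix (w i @ [(False, c i)]) (w j)" "prefix (w k @ [(True, c k)]) (w j)"
      using 3 desc(1) desc_j cases_i cases_j by auto
    \<comment> \<open>Two prefixes of the same word are comparable, and these two are distinct
      because their last letters differ in sign. Hence one of the outer words extends the other, and
      this selects the mixed relation.\<close>
    then have "prefix (w i @ [(False, c i)]) (w k @ [(True, c k)]) \<or>
        prefix (w k @ [(True, c k)]) (w i @ [(False, c i)])"
      using prefix_same_cases by blast
    then consider "prefix (w i @ [(False, c i)]) (w k)" | "prefix (w k @ [(True, c k)]) (w i)"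
      by (auto simp: prefix_snoc)
    then show ?thesis
    proof cases
      case p': 1
      note l = sh(1)[OF g123(2) p(1), folded y123] sh(2)[OF g123(2) p(2), folded y123]
        sh(1)[OF g123(3) p', folded y123] sh2(2)[OF g123(2) p' p(2), folded y123]
      have e: "conj_by False (conj_by True y1 y3) (conj_by True y1 y2) = conj_by True y1 (conj_by False y3 y2)"
        by (rule conj_by_distrib)
      show ?thesis
        using 3 i jk l braid_rel_mixed1[OF n3 i j_def] e
        by (intro joinableI[of "[(True, j), (False, i)]" "[(True, i), (True, j)]"])
          (simp_all add: arg_cong[OF y, of "move _"] tr height del: move.simps)
    next
      case p': 2
      note l = sh(1)[OF g123(2) p(1), folded y123] sh(2)[OF g123(2) p(2), folded y123]
        sh(2)[OF g123(1) p', folded y123] sh2(3)[OF g123(2) p' p(1), folded y123]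
      have e: "conj_by True (conj_by False y3 y1) (conj_by False y3 y2) = conj_by False y3 (conj_by True y1 y2)"
        by (rule conj_by_distrib)
      show ?thesis
        using 3 i jk l braid_rel_mixed2[OF n3 i j_def] e
        by (intro joinableI[of "[(False, j), (False, i)]" "[(False, i), (True, j)]"])
          (simp_all add: arg_cong[OF y, of "move _"] tr height del: move.simps)
    qed
  next
    case 4
    have "prefix (w j @ [(True, c j)]) (w i)" "prefix (w j @ [(False, c j)]) (w k)"
      using 4 desc(1) desc_j cases_i cases_j by auto
    then show ?thesis
      using no_opposite_descents[OF n3 H d i] by (simp add: j_def k_def)
  qed
  then show ?thesis
    by (simp add: j_def)
qed

text \<open>Invariants of the orbit of \<open>X\<close>. The polygon is demanded for n at least 3;
  for n = 2 the group is free on two generators and distinct descents never meet at a tuple.\<close>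

definition in_orbit :: "(nat \<Rightarrow> freegrp) \<Rightarrow> bool" where
  "in_orbit y \<longleftrightarrow> admissible y \<and> (3 \<le> n \<longrightarrow> (\<exists>H. polygon_of H y))"

lemma in_orbit_admissible: "in_orbit y \<Longrightarrow> admissible y"
  by (simp add: in_orbit_def)

lemma in_orbit_X: "in_orbit X"
  using admissible_X polygon_of_X by (auto simp: in_orbit_def)

lemma in_orbit_move: "in_orbit y \<Longrightarrow> snd a \<in> {1..n} \<Longrightarrow> in_orbit (move a y)"
  using admissible_move[of y "snd a" "fst a"] polygon_of_move[of _ y "snd a" "fst a"]
  by (auto simp: in_orbit_def)

lemma joinable_descents:
  assumes y: "in_orbit y" and ab: "a \<noteq> b" and range: "snd a \<in> {1..n}" "snd b \<in> {1..n}"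
    and desc: "descends a y" "descends b y"
  shows "joinable a b y"
proof -
  obtain c w where d: "normal_data c w y"
    using admissible_normal_data[OF in_orbit_admissible[OF y]] by blast
  obtain s i t j where a: "a = (s, i)" and b: "b = (t, j)"
    by (cases a, cases b)
  have i: "i \<in> {1..n}" and j: "j \<in> {1..n}"
    using range by (simp_all add: a b)
  have pre: "descends (r, k) y \<longleftrightarrow> (if r then prefix (w k @ [(False, c k)]) (w (nxt n k))
      else prefix (w (nxt n k) @ [(True, c (nxt n k))]) (w k))" if "k \<in> {1..n}" for r k
    using descends_cases(1,2)[OF d that] by (cases r) auto
  have not_both: False if "prefix (u @ [x]) v" "prefix (v @ [z]) u" for u v :: word and x z
    using that by (auto dest!: prefix_length_le)
  show ?thesis
  proof (cases "i = j")
    case True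
    then have "t = (\<not> s)"
      using ab by (auto simp: a b)
    then show ?thesis
      using desc True not_both[of "w i" "(False, c i)" "w (nxt n i)" "(True, c (nxt n i))"]
      by (cases s) (auto simp: a b pre[OF i] pre[OF j])
  next
    case False
    consider "j \<noteq> nxt n i" "i \<noteq> nxt n j" | "j = nxt n i" "3 \<le> n" | "i = nxt n j" "3 \<le> n" | "n = 2"
      using n_ge_2 by linarith
    then show ?thesis
    proof cases
      case 1
      then show ?thesis
        using joinable_far[OF i j False] desc by (simp add: a b)
    next
      case 2
      then obtain H where "polygon_of H y"
        using y by (auto simp: in_orbit_def)
      then show ?thesis
        using joinable_adjacent[OF 2(2) i d] desc 2 by (simp add: a b)
    next
      case 3
      then obtain H where "polygon_of H y"
        using y by (auto simp: in_orbit_def)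
      then show ?thesis
        using joinable_adjacent[OF 3(2) j d] desc 3 by (simp add: a b joinable_sym)
    next
      case 4
      then have nxt: "nxt n i = j" "nxt n j = i"
        using i j False by (auto simp: nxt_def)
      have D: "if s then prefix (w i @ [(False, c i)]) (w j) else prefix (w j @ [(True, c j)]) (w i)"
          "if t then prefix (w j @ [(False, c j)]) (w i) else prefix (w i @ [(True, c i)]) (w j)"
        using desc unfolding a b pre[OF i] pre[OF j] nxt by blast+
      \<comment> \<open>For n = 2 the two positions are neighbours in both directions, so all
        descents compare the same two words: they either ask each word to be longer than the other
        or continue one prefix with two different letters.\<close>
      have "\<not> (prefix (u @ [(True, x)]) v \<and> prefix (u @ [(False, x)]) v)" for u v :: word and x
        by (auto simp: prefix_def)
      then have False
        using D not_both by (cases s; cases t; simp) blast+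
      then show ?thesis ..
    qed
  qed
qed

section \<open>Uniqueness of descending paths up to braid relations\<close>

fun descent :: "word \<Rightarrow> (nat \<Rightarrow> freegrp) \<Rightarrow> bool" where
  "descent [] y \<longleftrightarrow> y = X"
| "descent (a # u) y \<longleftrightarrow> snd a \<in> {1..n} \<and> descends a y \<and> descent u (move a y)"

lemma descent_exists: "in_orbit y \<Longrightarrow> \<exists>u. descent u y"
proof (induction "height y" arbitrary: y rule: less_induct)
  case less
  show ?case
  proof (cases "y = X")
    case True
    then show ?thesis
      by (intro exI[of _ "[]"]) simp
  next
    case False
    then obtain b i where i: "i \<in> {1..n}" "descends (b, i) y"
      using no_descent_eq_X in_orbit_admissible[OF less.prems] by blast
    then obtain u where "descent u (move (b, i) y)"
      using less.hyps[of "move (b, i) y"] in_orbit_move[OF less.prems, of "(b, i)"]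
      by (auto simp: descends_def)
    then show ?thesis
      using i by (intro exI[of _ "(b, i) # u"]) simp
  qed
qed

lemma ascends:
  assumes "in_orbit y" "snd a \<in> {1..n}" "\<not> descends a y"
  shows "descends (inv_letter a) (move a y)"
proof -
  obtain c w where "normal_data c w y"
    using admissible_normal_data[OF in_orbit_admissible[OF assms(1)]] by blast
  then have "height y < height (move a y)"
    using descends_cases(3)[of c w y "snd a" "fst a"] assms(2,3) by simp
  then show ?thesis
    by (simp add: descends_def)
qed

text \<open>Along a path, the class of the part already read followed by a descent from the current
  tuple does not change: a falling letter extends a descent, a rising one is a descent read
  backwards. Uniqueness is assumed below \<open>m\<close> only, so the lemma serves inside the
  induction of \<open>descent_unique\<close> and again after it.\<close>

lemma descent_transport:
  assumes unique: "\<And>y u v. in_orbit y \<Longrightarrow> height y < m \<Longrightarrow> descent u y \<Longrightarrow> descent v y \<Longrightarrow> braid_eq n u v"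
  shows "p \<in> sigma_words n \<Longrightarrow> below m p y \<Longrightarrow> in_orbit y \<Longrightarrow> descent u y \<Longrightarrow>
    descent r (fold move p y) \<Longrightarrow> braid_eq n u (p @ r)"
proof (induction p arbitrary: y u)
  case Nil
  then show ?case
    using unique by simp
next
  case (Cons a p)
  have a: "snd a \<in> {1..n}" and p: "p \<in> sigma_words n"
    using Cons.prems by (cases a; simp)+
  have orb: "in_orbit (move a y)"
    using Cons.prems in_orbit_move a by blast
  then obtain s where s: "descent s (move a y)"
    using descent_exists by blast
  have IH: "braid_eq n s (p @ r)"
    using Cons.IH[OF p _ orb s] Cons.prems by simp
  have "below m p (move a y)"
    using Cons.prems by simp
  then have less: "height (move a y) < m"
    by (cases p) simp_all
  have "braid_eq n u (a # s)"
  proof (cases "descends a y")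
    case True
    then show ?thesis
      using unique[of y u "a # s"] Cons.prems a s by simp
  next
    case False
    have "descent (inv_letter a # u) (move a y)"
      using ascends[OF _ a False] Cons.prems a by simp
    then have "braid_eq n s (inv_letter a # u)"
      using unique[OF orb less s] by blast
    then have "braid_eq n (a # s) (a # inv_letter a # u)"
      by (rule braid_eq_Cons)
    also have "braid_eq n \<dots> u"
      using braid_eq.cancel[of n "[]" a u] by simp
    finally show ?thesis
      by (rule braid_eq.sym)
  qed
  also have "braid_eq n (a # s) (a # p @ r)"
    using IH by (rule braid_eq_Cons)
  finally show ?case
    by simp
qed

lemma descent_unique: "in_orbit y \<Longrightarrow> descent u y \<Longrightarrow> descent v y \<Longrightarrow> braid_eq n u v"
proof (induction "height y" arbitrary: y u v rule: less_induct)
  case less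
  have noX: "\<not> descends a X" if "snd a \<in> {1..n}" for a
    using no_descent_X[OF that, of "fst a"] by simp
  show ?case
  proof (cases u)
    case Nil
    then have "v = []"
      using less.prems noX[of "hd v"] by (cases v) auto
    then show ?thesis
      using Nil by (simp add: braid_eq.refl)
  next
    case u: (Cons a u')
    then obtain b v' where v: "v = b # v'"
      using less.prems noX[of a] by (cases v) auto
    have a: "snd a \<in> {1..n}" "descends a y" "descent u' (move a y)"
      and b: "snd b \<in> {1..n}" "descends b y" "descent v' (move b y)"
      using less.prems u v by auto
    show ?thesis
    proof (cases "a = b")
      case True
      have "braid_eq n u' v'"
        using less.hyps[of "move a y" u' v'] in_orbit_move[OF less.prems(1) a(1)] a b True
        by (simp add: descends_def)
      then show ?thesis
        using True u v by (simp add: braid_eq_Cons)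
    next
      case False
      obtain p q where pq: "p \<in> sigma_words n" "q \<in> sigma_words n" "braid_eq n (a # p) (b # q)"
        "fold move p (move a y) = fold move q (move b y)"
        "below (height y) p (move a y)" "below (height y) q (move b y)"
        using joinable_descents[OF less.prems(1) False] a b unfolding joinable_def by blast
      have orb: "in_orbit (move a y)" "in_orbit (move b y)"
        using in_orbit_move less.prems(1) a b by blast+
      have "in_orbit (fold move p z)" if "in_orbit z" "p \<in> sigma_words n" for z p
        using that by (induction p arbitrary: z) (auto simp: in_orbit_move)
      \<comment> \<open>A descent from the meeting point of the two closing paths; both given
        descents are compared with it.\<close>
      then obtain r where r: "descent r (fold move p (move a y))"
        using descent_exists orb(1) pq(1) by blast
      have "braid_eq n u' (p @ r)"
        using descent_transport[OF less.hyps pq(1) pq(5) orb(1) a(3) r] .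
      then have "braid_eq n u (a # p @ r)"
        using u by (simp add: braid_eq_Cons)
      also have "braid_eq n (a # p @ r) (b # q @ r)"
        using braid_eq_append[OF pq(3) braid_eq.refl, of r] by simp
      also have "braid_eq n v' (q @ r)"
        using descent_transport[OF less.hyps pq(2) pq(6) orb(2) b(3)] r pq(4) by simp
      then have "braid_eq n (b # q @ r) v"
        using v by (simp add: braid_eq_Cons braid_eq.sym)
      finally show ?thesis .
    qed
  qed
qed

lemma below_exists: "\<exists>m. below m p y"
proof (induction p arbitrary: y)
  case (Cons a p)
  have mono: "below m q z \<Longrightarrow> m \<le> m' \<Longrightarrow> below m' q z" for m m' q z
    by (induction q arbitrary: z) auto
  obtain m where "below m p (move a y)"
    using Cons by blast
  then show ?case
    using mono by (intro exI[of _ "max m (Suc (height y))"]) auto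
qed auto

text \<open>Transport along the loop with the empty descent at both ends; a bound for the heights on
  the loop exists because it is finite.\<close>

lemma stabilizer_X_trivial:
  assumes "u \<in> sigma_words n" "fold move u X = X"
  shows "braid_eq n u []"
proof -
  obtain m where "below m u X"
    using below_exists by blast
  then have "braid_eq n [] (u @ [])"
    using assms by (intro descent_transport[OF descent_unique]) (simp_all add: in_orbit_X)
  then show ?thesis
    by (simp add: braid_eq.sym)
qed

lemma rho_word_faithful:
  assumes "u \<in> sigma_words n" "v \<in> sigma_words n" "\<forall>k\<in>{1..n}. rho_word n u k = rho_word n v k"
  shows "braid_eq n u v"
proof -
  have "fold move u X k = fold move v X k" for k
    using assms moves_outside[of u k X] moves_outside[of v k X] rho_word_eq_rep
    by (cases "k \<in> {1..n}") (metis elt_rep, simp)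
  then have "fold move u X = fold move v X"
    by (rule ext)
  then have "fold move (u @ inv_word v) X = X"
    using moves_inv_word[of v X] by simp
  then show ?thesis
    using assms stabilizer_X_trivial[of "u @ inv_word v"]
    by (simp add: sigma_words_inv_word braid_eq_iff_quotient[of n u v])
qed

lemma image_iff_admissible:
  "(\<exists>u\<in>sigma_words n. y = fold move u X) \<longleftrightarrow> admissible y"
  using admissible_moves[OF _ admissible_X] admissible_reach sigma_words_inv_word moves_inv_word
  by metis

end

section \<open>Endomorphisms of the free group\<close>

lemma carrier_free_group:
  "w \<in> carrier (free_group n) \<longleftrightarrow> reduced w \<and> elt w \<in> Fsub n"
  by (auto simp: Fsub_def rep_elt_reduced free_group_def)

lemma elt_mult: "elt (x \<otimes>\<^bsub>free_group n\<^esub> y) = elt x + elt y"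
  by (simp add: free_group_def elt_append)

lemma one_free_group: "\<one>\<^bsub>free_group n\<^esub> = []"
  by (simp add: free_group_def)

lemma carrier_eqI:
  "x \<in> carrier (free_group n) \<Longrightarrow> y \<in> carrier (free_group n) \<Longrightarrow> elt x = elt y \<Longrightarrow> x = y"
  by (metis carrier_free_group rep_elt_reduced)

lemma group_free_group: "group (free_group n)"
proof (rule groupI)
  fix x y z
  assume x: "x \<in> carrier (free_group n)" and y: "y \<in> carrier (free_group n)"
  show xy: "x \<otimes>\<^bsub>free_group n\<^esub> y \<in> carrier (free_group n)"
    using x y by (simp add: carrier_free_group elt_mult Fsub_add)
      (simp add: free_group_def reduced_red)
next
  show "\<one>\<^bsub>free_group n\<^esub> \<in> carrier (free_group n)"
    by (simp add: one_free_group carrier_free_group)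
next
  fix x y z
  assume "x \<in> carrier (free_group n)" "y \<in> carrier (free_group n)" "z \<in> carrier (free_group n)"
  show "x \<otimes>\<^bsub>free_group n\<^esub> y \<otimes>\<^bsub>free_group n\<^esub> z
      = x \<otimes>\<^bsub>free_group n\<^esub> (y \<otimes>\<^bsub>free_group n\<^esub> z)"
    by (simp add: free_group_def red_append_red1 red_append_red2)
next
  fix x
  assume x: "x \<in> carrier (free_group n)"
  then show "\<one>\<^bsub>free_group n\<^esub> \<otimes>\<^bsub>free_group n\<^esub> x = x"
    by (simp add: free_group_def red_reduced)
  have "inv_word x \<in> carrier (free_group n)"
    using x by (simp add: carrier_free_group reduced_inv_word elt_inv_word Fsub_uminus)
  moreover have "inv_word x \<otimes>\<^bsub>free_group n\<^esub> x = \<one>\<^bsub>free_group n\<^esub>"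
    by (simp add: free_group_def red_inv_left)
  ultimately show "\<exists>y\<in>carrier (free_group n). y \<otimes>\<^bsub>free_group n\<^esub> x = \<one>\<^bsub>free_group n\<^esub>"
    by blast
qed

lemma elt_inv:
  assumes "x \<in> carrier (free_group n)"
  shows "elt (inv\<^bsub>free_group n\<^esub> x) = - elt x"
proof -
  have "elt (inv\<^bsub>free_group n\<^esub> x) + elt x = 0"
    using arg_cong[OF group.l_inv[OF group_free_group assms], of elt]
    by (simp add: elt_mult one_free_group)
  then show ?thesis
    by (simp add: eq_neg_iff_add_eq_0)
qed

lemma gen_in_carrier: "i \<in> {1..n} \<Longrightarrow> gen i \<in> carrier (free_group n)"
  using Fsub_X[of i n] by (simp add: carrier_free_group gen_def X_def)

lemma elt_gen: "elt (gen i) = X i"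
  by (simp add: gen_def X_def)

lemma elt_hom:
  assumes \<phi>: "\<phi> \<in> hom (free_group n) (free_group n)" and x: "x \<in> carrier (free_group n)"
    and y: "\<And>i. i \<in> {1..n} \<Longrightarrow> y i = elt (\<phi> (gen i))"
  shows "elt (\<phi> x) = ghom y (elt x)"
proof -
  have mult: "elt (\<phi> (u \<otimes>\<^bsub>free_group n\<^esub> v)) = elt (\<phi> u) + elt (\<phi> v)"
    if "u \<in> carrier (free_group n)" "v \<in> carrier (free_group n)" for u v
    using hom_mult[OF \<phi> that] by (simp add: elt_mult)
  have "[] \<in> carrier (free_group n)" "[] \<otimes>\<^bsub>free_group n\<^esub> [] = []"
    by (simp_all add: free_group_def)
  then have Nil: "elt (\<phi> []) = 0"
    using mult[of "[]" "[]"] by (metis add.right_neutral add_left_cancel)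
  have letter: "elt (\<phi> [(b, i)]) = (if b then y i else - y i)" if i: "i \<in> {1..n}" for b i
  proof (cases b)
    case True
    then show ?thesis
      using y[OF i] by (simp add: gen_def)
  next
    case False
    have inv: "[(False, i)] \<in> carrier (free_group n)"
      using Fsub_uminus[OF Fsub_X[OF i]] by (simp add: carrier_free_group elt_letter)
    have "[(False, i)] \<otimes>\<^bsub>free_group n\<^esub> gen i = []"
      by (simp add: free_group_def gen_def)
    then have "elt (\<phi> [(False, i)]) + y i = 0"
      using mult[OF inv gen_in_carrier[OF i]] Nil y[OF i] by simp
    then show ?thesis
      using False by (simp add: eq_neg_iff_add_eq_0)
  qed
  show ?thesis
    using x
  proof (induction x)
    case (Cons a x)
    obtain b i where a: "a = (b, i)"
      by (cases a)
    have i: "i \<in> {1..n}" and carr: "[a] \<in> carrier (free_group n)" "x \<in> carrier (free_group n)"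
      using Cons.prems by (auto simp: free_group_def reduced_Cons a)
    have "a # x = [a] \<otimes>\<^bsub>free_group n\<^esub> x"
      using Cons.prems by (simp add: free_group_def red_reduced del: red.simps)
    then have "elt (\<phi> (a # x)) = elt (\<phi> [a]) + elt (\<phi> x)"
      using mult[OF carr] by simp
    then show ?case
      using Cons.IH[OF carr(2)] letter[OF i, of b] by (simp add: a ghom_elt_Cons)
  qed (simp add: Nil)
qed

context annulus
begin

lemma ghom_boundary: "ghom f (boundary y) = boundary (\<lambda>i. ghom f (y i))"
proof -
  have "ghom f (sum_list (map y xs)) = sum_list (map (\<lambda>i. ghom f (y i)) xs)" for xs
    by (induction xs) (simp_all add: ghom_add)
  then show ?thesis
    by (simp add: boundary_def)
qed

lemma elt_prod_gens: "elt (prod_gens n) = boundary X"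
proof -
  have "elt (map (Pair True) xs) = sum_list (map X xs)" for xs
  proof (induction xs)
    case (Cons x xs)
    then show ?case
      using elt_Cons[of "(True, x)" "map (Pair True) xs"] by (simp add: X_def)
  qed simp
  then show ?thesis
    by (simp add: prod_gens_def boundary_def)
qed

lemma prod_gens_in_carrier: "prod_gens n \<in> carrier (free_group n)"
  using reduced_pos[of "[1..<Suc n]"]
  by (auto simp: free_group_def pos_def prod_gens_def)

text \<open>An endomorphism is encoded by the tuple of images of the generators, extended by the
  identity to the generators outside \<^term>\<open>{1..n}\<close>.\<close>

definition images :: "(word \<Rightarrow> word) \<Rightarrow> nat \<Rightarrow> freegrp" where
  "images \<phi> i = (if i \<in> {1..n} then elt (\<phi> (gen i)) else X i)"

lemma elt_hom_images:
  "\<phi> \<in> hom (free_group n) (free_group n) \<Longrightarrow> x \<in> carrier (free_group n) \<Longrightarrow>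
    elt (\<phi> x) = ghom (images \<phi>) (elt x)"
  by (rule elt_hom) (auto simp: images_def)

lemma eq_subst_rho_iff:
  assumes \<phi>: "\<phi> \<in> hom (free_group n) (free_group n)" and u: "u \<in> sigma_words n"
  shows "(\<forall>x\<in>carrier (free_group n). \<phi> x = subst (rho_word n u) x) \<longleftrightarrow> images \<phi> = fold move u X"
proof
  assume "\<forall>x\<in>carrier (free_group n). \<phi> x = subst (rho_word n u) x"
  then have "images \<phi> i = fold move u X i" if "i \<in> {1..n}" for i
    using gen_in_carrier[OF that] that
    by (simp add: images_def elt_subst elt_gen fun_cong[OF elt_rho_word[OF u]])
  moreover have "images \<phi> i = fold move u X i" if "i \<notin> {1..n}" for i
    using that moves_outside[OF u that] by (auto simp: images_def)
  ultimately show "images \<phi> = fold move u X"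
    by blast
next
  assume eq: "images \<phi> = fold move u X"
  show "\<forall>x\<in>carrier (free_group n). \<phi> x = subst (rho_word n u) x"
  proof
    fix x
    assume x: "x \<in> carrier (free_group n)"
    have "elt (\<phi> x) = elt (subst (rho_word n u) x)"
      using elt_hom_images[OF \<phi> x] eq elt_rho_word[OF u] by (simp add: elt_subst)
    moreover have "reduced (\<phi> x)"
      using hom_in_carrier[OF \<phi> x] by (simp add: carrier_free_group)
    moreover have "reduced (subst (rho_word n u) x)"
      by (simp add: subst_def reduced_red)
    ultimately show "\<phi> x = subst (rho_word n u) x"
      by (metis rep_elt_reduced)
  qed
qed

lemma conjugates_iff_conj_tuple:
  assumes \<phi>: "\<phi> \<in> hom (free_group n) (free_group n)"
  shows "(\<exists>ws \<pi>. \<pi> permutes {1..n} \<and>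
      (\<forall>i\<in>{1..n}. ws i \<in> carrier (free_group n) \<and>
        \<phi> (gen i) = ws i \<otimes>\<^bsub>free_group n\<^esub> gen (\<pi> i) \<otimes>\<^bsub>free_group n\<^esub> inv\<^bsub>free_group n\<^esub> (ws i)))
    \<longleftrightarrow> (\<exists>c. conj_tuple c (images \<phi>))"
proof -
  interpret G: group "free_group n"
    by (rule group_free_group)
  have iff: "\<phi> (gen i) = v \<otimes>\<^bsub>free_group n\<^esub> gen (\<pi> i) \<otimes>\<^bsub>free_group n\<^esub> inv\<^bsub>free_group n\<^esub> v
      \<longleftrightarrow> images \<phi> i = elt v + X (\<pi> i) - elt v"
    if "\<pi> permutes {1..n}" "i \<in> {1..n}" "v \<in> carrier (free_group n)" for \<pi> i v
  proof -
    have \<pi>i: "\<pi> i \<in> {1..n}"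
      using permutes_in_image[OF that(1)] that(2) by blast
    have "images \<phi> i = elt (\<phi> (gen i))"
      using that by (simp add: images_def)
    moreover have "elt (v \<otimes>\<^bsub>free_group n\<^esub> gen (\<pi> i) \<otimes>\<^bsub>free_group n\<^esub> inv\<^bsub>free_group n\<^esub> v)
        = elt v + X (\<pi> i) - elt v"
      by (simp add: elt_mult elt_gen elt_inv[OF that(3)])
    moreover have "\<phi> (gen i) \<in> carrier (free_group n)"
      using hom_in_carrier[OF \<phi> gen_in_carrier[OF that(2)]] .
    moreover have "v \<otimes>\<^bsub>free_group n\<^esub> gen (\<pi> i) \<otimes>\<^bsub>free_group n\<^esub> inv\<^bsub>free_group n\<^esub> v
        \<in> carrier (free_group n)"
      using that(3) gen_in_carrier[OF \<pi>i] by simp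
    ultimately show ?thesis
      using carrier_eqI by metis
  qed
  show ?thesis
  proof
    assume "\<exists>ws \<pi>. \<pi> permutes {1..n} \<and>
      (\<forall>i\<in>{1..n}. ws i \<in> carrier (free_group n) \<and>
        \<phi> (gen i) = ws i \<otimes>\<^bsub>free_group n\<^esub> gen (\<pi> i) \<otimes>\<^bsub>free_group n\<^esub> inv\<^bsub>free_group n\<^esub> (ws i))"
    then obtain ws \<pi> where *: "\<pi> permutes {1..n}"
      "\<And>i. i \<in> {1..n} \<Longrightarrow> ws i \<in> carrier (free_group n) \<and>
        \<phi> (gen i) = ws i \<otimes>\<^bsub>free_group n\<^esub> gen (\<pi> i) \<otimes>\<^bsub>free_group n\<^esub> inv\<^bsub>free_group n\<^esub> (ws i)"
      by blast
    have "\<exists>g\<in>Fsub n. images \<phi> i = g + X (\<pi> i) - g" if "i \<in> {1..n}" for i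
      using *(2)[OF that] iff[OF *(1) that, of "ws i"] carrier_free_group by blast
    then show "\<exists>c. conj_tuple c (images \<phi>)"
      using *(1) unfolding conj_tuple_def by blast
  next
    assume "\<exists>c. conj_tuple c (images \<phi>)"
    then obtain \<pi> where \<pi>: "\<pi> permutes {1..n}"
        "\<forall>i\<in>{1..n}. \<exists>g\<in>Fsub n. images \<phi> i = g + X (\<pi> i) - g"
      unfolding conj_tuple_def by blast
    then obtain g where g: "\<And>i. i \<in> {1..n} \<Longrightarrow> g i \<in> Fsub n \<and> images \<phi> i = g i + X (\<pi> i) - g i"
      by metis
    have "rep (g i) \<in> carrier (free_group n) \<and> \<phi> (gen i) = rep (g i) \<otimes>\<^bsub>free_group n\<^esub> gen (\<pi> i)
        \<otimes>\<^bsub>free_group n\<^esub> inv\<^bsub>free_group n\<^esub> (rep (g i))" if "i \<in> {1..n}" for i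
    proof -
      have c: "rep (g i) \<in> carrier (free_group n)"
        using g[OF that] by (simp add: carrier_free_group)
      then show ?thesis
        using iff[OF \<pi>(1) that c] g[OF that] by simp
    qed
    then show "\<exists>ws \<pi>. \<pi> permutes {1..n} \<and>
      (\<forall>i\<in>{1..n}. ws i \<in> carrier (free_group n) \<and>
        \<phi> (gen i) = ws i \<otimes>\<^bsub>free_group n\<^esub> gen (\<pi> i) \<otimes>\<^bsub>free_group n\<^esub> inv\<^bsub>free_group n\<^esub> (ws i))"
      using \<pi>(1) by (intro exI[of _ "\<lambda>i. rep (g i)"] exI[of _ \<pi>]) blast
  qed
qed

lemma boundary_condition_iff:
  assumes \<phi>: "\<phi> \<in> hom (free_group n) (free_group n)"
  shows "(\<exists>w\<in>carrier (free_group n). alg_len w = 0 \<and>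
      \<phi> (prod_gens n) = w \<otimes>\<^bsub>free_group n\<^esub> prod_gens n \<otimes>\<^bsub>free_group n\<^esub> inv\<^bsub>free_group n\<^esub> w)
    \<longleftrightarrow> (\<exists>g\<in>Fsub n. glen0 g = 0 \<and> boundary (images \<phi>) = g + boundary X - g)"
proof -
  interpret G: group "free_group n"
    by (rule group_free_group)
  have iff: "\<phi> (prod_gens n) = w \<otimes>\<^bsub>free_group n\<^esub> prod_gens n \<otimes>\<^bsub>free_group n\<^esub> inv\<^bsub>free_group n\<^esub> w
      \<longleftrightarrow> boundary (images \<phi>) = elt w + boundary X - elt w"
    if w: "w \<in> carrier (free_group n)" for w
  proof -
    have "boundary (images \<phi>) = elt (\<phi> (prod_gens n))"
      using elt_hom_images[OF \<phi> prod_gens_in_carrier] by (simp add: elt_prod_gens ghom_boundary)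
    moreover have "elt (w \<otimes>\<^bsub>free_group n\<^esub> prod_gens n \<otimes>\<^bsub>free_group n\<^esub> inv\<^bsub>free_group n\<^esub> w)
        = elt w + boundary X - elt w"
      by (simp add: elt_mult elt_prod_gens elt_inv[OF w])
    moreover have "\<phi> (prod_gens n) \<in> carrier (free_group n)"
      using hom_in_carrier[OF \<phi> prod_gens_in_carrier] .
    moreover have "w \<otimes>\<^bsub>free_group n\<^esub> prod_gens n \<otimes>\<^bsub>free_group n\<^esub> inv\<^bsub>free_group n\<^esub> w
        \<in> carrier (free_group n)"
      using w prod_gens_in_carrier by simp
    ultimately show ?thesis
      using carrier_eqI by metis
  qed
  show ?thesis
  proof
    assume "\<exists>w\<in>carrier (free_group n). alg_len w = 0 \<and>
      \<phi> (prod_gens n) = w \<otimes>\<^bsub>free_group n\<^esub> prod_gens n \<otimes>\<^bsub>free_group n\<^esub> inv\<^bsub>free_group n\<^esub> w"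
    then obtain w where w: "w \<in> carrier (free_group n)" "alg_len w = 0"
      "boundary (images \<phi>) = elt w + boundary X - elt w"
      using iff by blast
    then show "\<exists>g\<in>Fsub n. glen0 g = 0 \<and> boundary (images \<phi>) = g + boundary X - g"
      by (intro bexI[of _ "elt w"]) (simp_all add: glen0_elt carrier_free_group)
  next
    assume "\<exists>g\<in>Fsub n. glen0 g = 0 \<and> boundary (images \<phi>) = g + boundary X - g"
    then obtain g where g: "g \<in> Fsub n" "glen0 g = 0" "boundary (images \<phi>) = g + boundary X - g"
      by blast
    have w: "rep g \<in> carrier (free_group n)"
      using g(1) by (simp add: carrier_free_group)
    then show "\<exists>w\<in>carrier (free_group n). alg_len w = 0 \<and>
      \<phi> (prod_gens n) = w \<otimes>\<^bsub>free_group n\<^esub> prod_gens n \<otimes>\<^bsub>free_group n\<^esub> inv\<^bsub>free_group n\<^esub> w"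
      using iff[OF w] g(2,3) by (intro bexI[of _ "rep g"]) (simp_all flip: glen0_elt)
  qed
qed

lemma admissible_images_iff:
  "admissible (images \<phi>) \<longleftrightarrow> (\<exists>c. conj_tuple c (images \<phi>)) \<and>
    (\<exists>g\<in>Fsub n. glen0 g = 0 \<and> boundary (images \<phi>) = g + boundary X - g)"
  unfolding admissible_def by (auto simp: images_def)

end

theorem theorem5p3:
  fixes n :: nat
  assumes "n \<ge> 2"
  shows "(\<forall>u \<in> sigma_words n. \<forall>v \<in> sigma_words n.
            (\<forall>k \<in> {1..n}. rho_word n u k = rho_word n v k) \<longrightarrow> braid_eq n u v)
       \<and> (\<forall>\<phi> \<in> iso (free_group n) (free_group n).
            (\<exists>u \<in> sigma_words n. \<forall>x \<in> carrier (free_group n). \<phi> x = subst (rho_word n u) x)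
            \<longleftrightarrow>
            ((\<exists>ws \<pi>. \<pi> permutes {1..n} \<and>
                (\<forall>i \<in> {1..n}. ws i \<in> carrier (free_group n) \<and>
                   \<phi> (gen i) = ws i \<otimes>\<^bsub>free_group n\<^esub> gen (\<pi> i)
                                \<otimes>\<^bsub>free_group n\<^esub> inv\<^bsub>free_group n\<^esub> (ws i)))
             \<and> (\<exists>w \<in> carrier (free_group n). alg_len w = 0 \<and>
                   \<phi> (prod_gens n) = w \<otimes>\<^bsub>free_group n\<^esub> prod_gens n
                                      \<otimes>\<^bsub>free_group n\<^esub> inv\<^bsub>free_group n\<^esub> w)))"
proof -
  interpret annulus n
    by standard (rule assms)
  show ?thesis
  proof (intro conjI ballI impI)
    fix u v
    assume "u \<in> sigma_words n" "v \<in> sigma_words n" "\<forall>k\<in>{1..n}. rho_word n u k = rho_word n v k"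
    then show "braid_eq n u v"
      by (rule rho_word_faithful)
  next
    fix \<phi>
    assume "\<phi> \<in> iso (free_group n) (free_group n)"
    then have \<phi>: "\<phi> \<in> hom (free_group n) (free_group n)"
      by (simp add: iso_def)
    have "(\<exists>u\<in>sigma_words n. \<forall>x\<in>carrier (free_group n). \<phi> x = subst (rho_word n u) x)
        \<longleftrightarrow> admissible (images \<phi>)"
      using eq_subst_rho_iff[OF \<phi>] image_iff_admissible by blast
    then show "(\<exists>u \<in> sigma_words n. \<forall>x \<in> carrier (free_group n). \<phi> x = subst (rho_word n u) x)
            \<longleftrightarrow>
            ((\<exists>ws \<pi>. \<pi> permutes {1..n} \<and>
                (\<forall>i \<in> {1..n}. ws i \<in> carrier (free_group n) \<and>
                   \<phi> (gen i) = ws i \<otimes>\<^bsub>free_group n\<^esub> gen (\<pi> i)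
                                \<otimes>\<^bsub>free_group n\<^esub> inv\<^bsub>free_group n\<^esub> (ws i)))
             \<and> (\<exists>w \<in> carrier (free_group n). alg_len w = 0 \<and>
                   \<phi> (prod_gens n) = w \<otimes>\<^bsub>free_group n\<^esub> prod_gens n
                                      \<otimes>\<^bsub>free_group n\<^esub> inv\<^bsub>free_group n\<^esub> w))"
      unfolding admissible_images_iff conjugates_iff_conj_tuple[OF \<phi>] boundary_condition_iff[OF \<phi>] .
  qed
qed

end
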